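(* Let $m,n\ge 1$ be integers, let $E\in\mathbb{R}^{m\times m}$ be a non-zero symmetric positive semi-definite matrix, and let $z_1,\dots,z_n$ be independent random vectors in $\mathbb{R}^m$ with $\mathbb{E}[z_jz_j^T]=E$ for $1\le j\le n$. Suppose there is $L>0$ with $\max_{1\le j\le n}\|z_j\|_2\le L$ and $\|E\|_2\le L^2$. Set $\widehat{E}=\frac1n\sum_{j=1}^n z_jz_j^T$. Then for any $0<\delta<1$, with probability at least $1-\delta$, $$\frac{\|\widehat{E}-E\|_2}{\|E\|_2}\le \gamma+\sqrt{\gamma(\gamma+6)},\qquad\text{where}\quad \gamma=\frac{1}{3n}\,\frac{L^2}{\|E\|_2}\,\ln\left(\frac{4}{\delta}\,\mathrm{intdim}(E)\right).$$
   Context: $\|\cdot\|_2$ is the Euclidean norm for vectors and the spectral (operator two-) norm for matrices. For a non-zero symmetric positive semi-definite matrix $P$, the intrinsic dimension is $\mathrm{intdim}(P)=\mathrm{trace}(P)/\|P\|_2$. The random vectors $z_j$ are not assumed to be identically distributed. *)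

theory Defs
  imports "HOL-Probability.Probability"
begin

text \<open>
  On \<open>real^'m\<close> the library \<open>norm\<close> is the Euclidean norm, but on the matrix type
  \<open>real^'n^'m\<close> it is the Frobenius norm.  The spectral norm is the operator norm
  of the associated linear map with respect to the Euclidean norms.
\<close>
definition spectral_norm :: "real^'n^'m \<Rightarrow> real" where
  "spectral_norm A = onorm ((*v) A)"

definition sym_psd :: "real^'m^'m \<Rightarrow> bool" where
  "sym_psd A \<longleftrightarrow> transpose A = A \<and> (\<forall>x. 0 \<le> x \<bullet> (A *v x))"

definition intdim :: "real^'m^'m \<Rightarrow> real" where
  "intdim P = trace P / spectral_norm P"

definition outer_product :: "real^'m \<Rightarrow> real^'n \<Rightarrow> real^'n^'m" where
  "outer_product x y = (\<chi> i j. x $ i * y $ j)"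

definition empirical_second_moment ::
    "nat \<Rightarrow> (nat \<Rightarrow> 'a \<Rightarrow> real^'m) \<Rightarrow> 'a \<Rightarrow> real^'m^'m" where
  "empirical_second_moment n z \<omega> =
     (1 / real n) *\<^sub>R (\<Sum>j=1..n. outer_product (z j \<omega>) (z j \<omega>))"

end

theory Submission
  imports Defs
begin

text \<open>
  The proof is the Laplace transform method for \<open>S = \<theta> (E' - E)\<close>, where \<open>E'\<close> is the empirical
  second moment, but Lieb's concavity theorem is not needed. For a symmetric matrix \<open>A\<close> and a
  random vector \<open>z\<close> with \<open>\<bar>z\<bar> \<le> L\<close> and second moment \<open>E\<close>, the
  Golden-Thompson inequality for a rank-one matrix followed by the convexity of \<open>tr exp\<close> gives

  \<open>\<^bold>E tr exp(A + a z z\<^sup>T) \<le> tr e\<^sup>A + b tr(E e\<^sup>A) \<le> tr exp(A + b E)\<close>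

  whenever \<open>exp(a r) - 1 \<le> b r\<close> on \<open>[0, L\<^sup>2]\<close>. The bound has the form of its left side again, so it can be
  iterated over the independent vectors starting from \<open>A = -\<theta>E\<close>, and yields \<open>\<^bold>E tr e\<^sup>S \<le> tr exp(c E)\<close> for
  a number \<open>c\<close>; the same holds for \<open>-S\<close>. Applying Markov's inequality to \<open>tr(e\<^sup>S + e\<^sup>-\<^sup>S - 2 I)\<close> brings in
  \<open>tr(exp(c E) - I)\<close>, which the convexity of \<open>exp\<close> bounds through the intrinsic dimension of \<open>E\<close>.
\<close>

section \<open>Spectral decomposition of symmetric matrices\<close>

text \<open>A maximiser \<open>x\<close> of the quadratic form on the unit sphere of
  \<open>S\<close> works. The residual \<open>v\<close> of the eigenvalue equation stays in
  \<open>S\<close> by invariance and is orthogonal to \<open>x\<close>; if it were nonzero, moving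
  from \<open>x\<close> along \<open>v\<close> would increase the Rayleigh quotient to first
  order.\<close>

lemma selfadjoint_eigenvector:
  fixes f :: "'a::euclidean_space \<Rightarrow> 'a"
  assumes f: "linear f" and sa: "\<And>x y. f x \<bullet> y = x \<bullet> f y"
    and S: "subspace S" "f ` S \<subseteq> S" and ne: "S \<noteq> {0}"
  obtains x \<mu> where "x \<in> S" "norm x = 1" "f x = \<mu> *\<^sub>R x"
proof -
  interpret linear f by (fact f)
  have "compact (S \<inter> sphere 0 1)"
    using S(1) by (intro closed_Int_compact closed_subspace) auto
  moreover have "S \<inter> sphere 0 1 \<noteq> {}"
  proof -
    from ne S(1) obtain v where "v \<in> S" "v \<noteq> 0"
      using subspace_0 by blast
    then have "(1 / norm v) *\<^sub>R v \<in> S \<inter> sphere 0 1"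
      using S(1) by (auto simp: subspace_scale)
    then show ?thesis by blast
  qed
  moreover have "continuous_on (S \<inter> sphere 0 1) (\<lambda>x. x \<bullet> f x)"
    using f by (intro continuous_intros linear_continuous_on) (simp add: linear_conv_bounded_linear)
  ultimately obtain x where x: "x \<in> S" "norm x = 1"
    and max: "\<And>y. y \<in> S \<Longrightarrow> norm y = 1 \<Longrightarrow> y \<bullet> f y \<le> x \<bullet> f x"
    using continuous_attains_sup[of "S \<inter> sphere 0 1" "\<lambda>x. x \<bullet> f x"]
    by (metis Int_iff mem_sphere_0)
  define \<mu> where "\<mu> = x \<bullet> f x"
  have max': "y \<bullet> f y \<le> \<mu> * (y \<bullet> y)" if "y \<in> S" for y
  proof (cases "y = 0")
    case False
    have "((1 / norm y) *\<^sub>R y) \<bullet> f ((1 / norm y) *\<^sub>R y) \<le> \<mu>"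
      unfolding \<mu>_def using that False S(1) by (intro max) (auto simp: subspace_scale)
    then show ?thesis using False
      by (simp add: scale dot_square_norm field_simps power2_eq_square)
  qed (simp add: \<mu>_def)
  define v where "v = f x - \<mu> *\<^sub>R x"
  have vS: "v \<in> S"
    unfolding v_def using x S by (intro subspace_diff) (auto simp: subspace_scale)
  have fx: "x \<bullet> x = 1" using x by (simp add: dot_square_norm)
  have vx: "v \<bullet> x = 0"
    using inner_commute[of x "f x"] by (simp add: v_def inner_diff_left fx \<mu>_def)
  have vfx: "v \<bullet> f x = v \<bullet> v"
    using vx by (simp add: v_def inner_diff_right inner_diff_left algebra_simps)
  \<comment> \<open>The maximality of \<open>\<mu>\<close> tested at \<open>x + t v\<close>: a gain
    linear in \<open>t\<close> against a quadratic term.\<close>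
  have key: "2 * t * (v \<bullet> v) \<le> t\<^sup>2 * (\<mu> * (v \<bullet> v) - v \<bullet> f v)" for t
  proof -
    have "(x + t *\<^sub>R v) \<bullet> f (x + t *\<^sub>R v) \<le> \<mu> * ((x + t *\<^sub>R v) \<bullet> (x + t *\<^sub>R v))"
      using x vS S by (intro max' subspace_add subspace_scale)
    moreover have "x \<bullet> f v = v \<bullet> v"
      using vfx sa[of x v] by (simp add: inner_commute)
    ultimately show ?thesis using vfx vx fx
      by (simp add: add scale inner_add_left inner_add_right \<mu>_def[symmetric] inner_commute
          algebra_simps power2_eq_square)
  qed
  have "v \<bullet> v = 0"
  proof (rule ccontr)
    assume "v \<bullet> v \<noteq> 0"
    then have pos: "v \<bullet> v > 0" by simp
    \<comment> \<open>The added 1 makes \<open>c\<close> positive, so that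
      \<open>t = (v \<bullet> v) / c\<close> can be inserted into \<open>key\<close>.\<close>
    define c where "c = \<bar>\<mu> * (v \<bullet> v) - v \<bullet> f v\<bar> + 1"
    have c: "c > 0" "\<mu> * (v \<bullet> v) - v \<bullet> f v \<le> c" by (auto simp: c_def)
    have "2 * ((v \<bullet> v) / c) * (v \<bullet> v) \<le> ((v \<bullet> v) / c)\<^sup>2 * c"
      using order_trans[OF key mult_left_mono[OF c(2) zero_le_power2]] .
    then have "2 * (v \<bullet> v)\<^sup>2 \<le> (v \<bullet> v)\<^sup>2"
      using c by (simp add: power2_eq_square field_simps)
    with pos show False by simp
  qed
  then have "f x = \<mu> *\<^sub>R x" by (simp add: v_def)
  with x show ?thesis by (rule that)
qed

text \<open>Induction on the dimension: after splitting off a unit eigenvector \<open>x\<close>,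
  self-adjointness keeps the orthogonal complement of \<open>x\<close> in \<open>S\<close>
  invariant. General invariant subspaces are treated so that the complement falls under the
  induction hypothesis.\<close>

lemma selfadjoint_eigenbasis_subspace:
  fixes f :: "'a::euclidean_space \<Rightarrow> 'a"
  assumes f: "linear f" and sa: "\<And>x y. f x \<bullet> y = x \<bullet> f y"
    and S: "subspace S" "f ` S \<subseteq> S"
  shows "\<exists>B. B \<subseteq> S \<and> pairwise orthogonal B \<and> span B = S \<and>
           (\<forall>b\<in>B. norm b = 1 \<and> (\<exists>\<mu>. f b = \<mu> *\<^sub>R b))"
  using S
proof (induction "dim S" arbitrary: S rule: less_induct)
  case less
  show ?case
  proof (cases "S = {0}")
    case True
    then show ?thesis by (intro exI[of _ "{}"]) auto
  next
    case False
    obtain x \<mu> where x: "x \<in> S" "norm x = 1" "f x = \<mu> *\<^sub>R x"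
      using selfadjoint_eigenvector[OF f sa less.prems False] by blast
    have xx: "x \<bullet> x = 1" using x by (simp add: dot_square_norm)
    define T where "T = S \<inter> {y. x \<bullet> y = 0}"
    have subT: "subspace T"
      unfolding T_def using less.prems by (intro subspace_inter subspace_hyperplane)
    have fT: "f ` T \<subseteq> T"
      using less.prems x by (auto simp: T_def simp flip: sa)
    have "T \<subset> S"
    proof -
      have "x \<notin> T" using xx by (simp add: T_def)
      moreover have "T \<subseteq> S" by (simp add: T_def)
      ultimately show ?thesis using x(1) by blast
    qed
    then have "dim T < dim S"
      using subT less.prems(1) by (intro dim_psubset) (metis span_eq_iff)
    from less.hyps[OF this subT fT] obtain B where B: "B \<subseteq> T" "pairwise orthogonal B"
      "span B = T" "\<forall>b\<in>B. norm b = 1 \<and> (\<exists>\<mu>. f b = \<mu> *\<^sub>R b)" by blast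
    have "span (insert x B) = S"
    proof
      show "span (insert x B) \<subseteq> S"
        using x B \<open>T \<subset> S\<close> less.prems by (intro span_minimal) auto
      show "S \<subseteq> span (insert x B)"
      proof
        fix y assume "y \<in> S"
        then have "y - (x \<bullet> y) *\<^sub>R x \<in> T"
          using x xx less.prems by (auto simp: T_def inner_diff_right intro!: subspace_diff subspace_scale)
        then show "y \<in> span (insert x B)"
          using B(3) by (auto simp: span_insert)
      qed
    qed
    moreover have "pairwise orthogonal (insert x B)"
      using B by (auto simp: pairwise_insert orthogonal_def T_def inner_commute)
    moreover have "insert x B \<subseteq> S" using x B \<open>T \<subset> S\<close> by auto
    ultimately show ?thesis using B(4) x by (intro exI[of _ "insert x B"]) auto
  qed
qed

definition orthonormal_basis :: "'a::euclidean_space set \<Rightarrow> bool" where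
  "orthonormal_basis B \<longleftrightarrow> pairwise orthogonal B \<and> (\<forall>b\<in>B. norm b = 1) \<and> span B = UNIV"

lemma orthonormal_basis_finite: "orthonormal_basis B \<Longrightarrow> finite B"
  unfolding orthonormal_basis_def by (meson pairwise_orthogonal_imp_finite)

lemma orthonormal_basis_inner:
  assumes "orthonormal_basis B" "b \<in> B" "c \<in> B"
  shows "b \<bullet> c = (if b = c then 1 else 0)"
  using assms by (auto simp: orthonormal_basis_def pairwise_def orthogonal_def dot_square_norm)

lemma orthonormal_basis_expansion:
  assumes B: "orthonormal_basis B"
  shows "(\<Sum>b\<in>B. (x \<bullet> b) *\<^sub>R b) = x"
  using orthonormal_basis_expand[of B x] orthonormal_basis_finite[OF B] B
  by (simp add: orthonormal_basis_def)

lemma orthonormal_basis_parseval: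
  assumes B: "orthonormal_basis B"
  shows "(\<Sum>b\<in>B. (x \<bullet> b) * (y \<bullet> b)) = x \<bullet> y"
proof -
  have "x \<bullet> y = (\<Sum>b\<in>B. (x \<bullet> b) *\<^sub>R b) \<bullet> y"
    by (simp add: orthonormal_basis_expansion[OF B])
  then show ?thesis 
    unfolding inner_sum_left inner_scaleR_left by (simp only: inner_commute[of y])
qed

text \<open>Indexing the eigenvalues by the basis vectors makes sums over \<open>B\<close> count
  multiplicities.\<close>

definition eigenbasis :: "real^'m^'m \<Rightarrow> (real^'m) set \<Rightarrow> (real^'m \<Rightarrow> real) \<Rightarrow> bool" where
  "eigenbasis A B \<nu> \<longleftrightarrow> orthonormal_basis B \<and> (\<forall>b\<in>B. A *v b = \<nu> b *\<^sub>R b)"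

lemma symmetric_inner:
  fixes A :: "real^'m^'m"
  assumes "transpose A = A"
  shows "(A *v x) \<bullet> y = x \<bullet> (A *v y)"
  by (metis assms dot_lmul_matrix vector_transpose_matrix)

lemma symmetric_eigenbasis:
  fixes A :: "real^'m^'m"
  assumes "transpose A = A"
  obtains B \<nu> where "eigenbasis A B \<nu>"
proof -
  obtain B where B: "pairwise orthogonal B" "span B = UNIV"
     "\<And>b. b \<in> B \<Longrightarrow> norm b = 1 \<and> (\<exists>\<mu>. A *v b = \<mu> *\<^sub>R b)"
    using selfadjoint_eigenbasis_subspace[of "(*v) A" UNIV] symmetric_inner[OF assms] by auto
  then have "eigenbasis A B (\<lambda>b. SOME \<mu>. A *v b = \<mu> *\<^sub>R b)"
    by (auto simp: eigenbasis_def orthonormal_basis_def intro: someI_ex)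
  then show ?thesis by (rule that)
qed

text \<open>Each diagonal entry is the inner product of a row with a coordinate vector; Parseval in
  \<open>B\<close> expands it.\<close>

lemma trace_orthonormal_basis:
  fixes A :: "real^'m^'m"
  assumes B: "orthonormal_basis B"
  shows "trace A = (\<Sum>b\<in>B. b \<bullet> (A *v b))"
proof -
  have "b \<bullet> (A *v b) = (\<Sum>i\<in>UNIV. (A *v b) $ i * (axis i 1 \<bullet> b))" for b
    by (subst inner_vec_def) (simp add: inner_axis' mult.commute)
  then have "(\<Sum>b\<in>B. b \<bullet> (A *v b)) = (\<Sum>i\<in>UNIV. \<Sum>b\<in>B. (A *v b) $ i * (axis i 1 \<bullet> b))"
    using sum.swap by simp
  also have "\<dots> = (\<Sum>i\<in>UNIV. \<Sum>b\<in>B. ((A $ i) \<bullet> b) * (axis i 1 \<bullet> b))"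
    by (simp add: matrix_vector_mul_component)
  also have "\<dots> = trace A"
    by (simp add: orthonormal_basis_parseval[OF B] trace_def inner_axis)
  finally show ?thesis ..
qed

section \<open>Trace exponentials\<close>

text \<open>
  The scalars \<open>x\<^sup>T e\<^sup>A x\<close> and \<open>tr e\<^sup>A\<close>, without constructing the matrix exponential itself.
\<close>

definition quad_exp :: "real^'m^'m \<Rightarrow> real^'m \<Rightarrow> real" where
  "quad_exp A x = (\<Sum>k. (x \<bullet> (((*v) A ^^ k) x)) / fact k)"

definition trace_exp :: "real^'m^'m \<Rightarrow> real" where
  "trace_exp A = (\<Sum>b\<in>Basis. quad_exp A b)"

lemma orthonormal_basis_norm:
  assumes "orthonormal_basis B"
  shows "(\<Sum>b\<in>B. (x \<bullet> b)\<^sup>2) = (norm x)\<^sup>2"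
  using orthonormal_basis_parseval[OF assms, of x x] by (simp add: power2_eq_square dot_square_norm)

lemma orthonormal_basis_Basis: "orthonormal_basis Basis"
  by (auto simp: orthonormal_basis_def pairwise_def orthogonal_def inner_not_same_Basis)

lemma eigenbasis_power:
  assumes "eigenbasis A B \<nu>"
  shows "((*v) A ^^ k) x = (\<Sum>b\<in>B. (\<nu> b ^ k * (x \<bullet> b)) *\<^sub>R b)"
proof (induction k)
  case 0
  then show ?case using assms by (simp add: eigenbasis_def orthonormal_basis_expansion)
next
  case (Suc k)
  have "A *v (\<Sum>b\<in>B. (\<nu> b ^ k * (x \<bullet> b)) *\<^sub>R b) = (\<Sum>b\<in>B. (\<nu> b ^ k * (x \<bullet> b)) *\<^sub>R (A *v b))"
    by (simp add: linear_sum[OF matrix_vector_mul_linear] matrix_vector_mult_scaleR)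
  also have "\<dots> = (\<Sum>b\<in>B. (\<nu> b ^ Suc k * (x \<bullet> b)) *\<^sub>R b)"
    using assms by (intro sum.cong) (auto simp: eigenbasis_def)
  finally show ?case using Suc by simp
qed

lemma eigenbasis_inner_power:
  assumes "eigenbasis A B \<nu>"
  shows "y \<bullet> (((*v) A ^^ k) x) = (\<Sum>b\<in>B. \<nu> b ^ k * (x \<bullet> b) * (y \<bullet> b))"
  by (simp add: eigenbasis_power[OF assms] inner_sum_right)

lemma eigenbasis_inner:
  assumes "eigenbasis A B \<nu>"
  shows "x \<bullet> (A *v x) = (\<Sum>b\<in>B. \<nu> b * (x \<bullet> b)\<^sup>2)"
  using eigenbasis_inner_power[OF assms, of x 1 x] by (simp add: power2_eq_square mult.assoc)

text \<open>The convergent series is recorded besides its value, because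
  \<open>quad_exp_rank_one_update_le\<close> compares it term by term with another series.\<close>

lemma quad_exp_sums:
  assumes "eigenbasis A B \<nu>"
  shows "(\<lambda>k. (x \<bullet> (((*v) A ^^ k) x)) / fact k) sums (\<Sum>b\<in>B. exp (\<nu> b) * (x \<bullet> b)\<^sup>2)"
proof -
  have "(\<lambda>k. \<Sum>b\<in>B. (\<nu> b ^ k /\<^sub>R fact k) * (x \<bullet> b)\<^sup>2) sums (\<Sum>b\<in>B. exp (\<nu> b) * (x \<bullet> b)\<^sup>2)"
    by (intro sums_sum sums_mult2 exp_converges)
  moreover have "(x \<bullet> (((*v) A ^^ k) x)) / fact k = (\<Sum>b\<in>B. (\<nu> b ^ k /\<^sub>R fact k) * (x \<bullet> b)\<^sup>2)" for k
    unfolding eigenbasis_inner_power[OF assms] sum_divide_distrib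
    by (intro sum.cong) (auto simp: power2_eq_square divide_inverse mult_ac)
  ultimately show ?thesis by simp
qed

lemma quad_exp_eigenbasis:
  "eigenbasis A B \<nu> \<Longrightarrow> quad_exp A x = (\<Sum>b\<in>B. exp (\<nu> b) * (x \<bullet> b)\<^sup>2)"
  unfolding quad_exp_def by (rule sums_unique[OF quad_exp_sums, symmetric])

text \<open>For every orthonormal basis the sum equals the sum of \<open>exp (\<nu> b)\<close>:
  after swapping sums, the squared coefficients of the unit vector \<open>b\<close> add up to
  1.\<close>

lemma trace_exp_orthonormal_basis:
  assumes "transpose A = A" "orthonormal_basis C"
  shows "trace_exp A = (\<Sum>c\<in>C. quad_exp A c)"
proof -
  obtain B \<nu> where B: "eigenbasis A B \<nu>" using symmetric_eigenbasis[OF assms(1)] .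
  have *: "(\<Sum>c\<in>C'. quad_exp A c) = (\<Sum>b\<in>B. exp (\<nu> b))" if C': "orthonormal_basis C'" for C'
  proof -
    have "(\<Sum>c\<in>C'. quad_exp A c) = (\<Sum>b\<in>B. \<Sum>c\<in>C'. exp (\<nu> b) * (c \<bullet> b)\<^sup>2)"
      unfolding quad_exp_eigenbasis[OF B] by (rule sum.swap)
    also have "\<dots> = (\<Sum>b\<in>B. exp (\<nu> b) * (norm b)\<^sup>2)"
      by (simp add: orthonormal_basis_norm[OF C', symmetric] sum_distrib_left inner_commute)
    also have "\<dots> = (\<Sum>b\<in>B. exp (\<nu> b))"
      using B by (auto simp: eigenbasis_def orthonormal_basis_def)
    finally show ?thesis .
  qed
  show ?thesis
    unfolding trace_exp_def using *[OF assms(2)] *[OF orthonormal_basis_Basis] by simp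
qed

lemma quad_exp_eigenvector:
  assumes "eigenbasis A B \<nu>" "b \<in> B"
  shows "quad_exp A b = exp (\<nu> b)"
proof -
  have on: "orthonormal_basis B" using assms by (simp add: eigenbasis_def)
  have "quad_exp A b = (\<Sum>c\<in>B. if b = c then exp (\<nu> c) else 0)"
    unfolding quad_exp_eigenbasis[OF assms(1)] using orthonormal_basis_inner[OF on assms(2)]
    by (intro sum.cong) auto
  then show ?thesis using assms(2) orthonormal_basis_finite[OF on] by simp
qed

lemma eigenbasis_symmetric:
  assumes "eigenbasis A B \<nu>"
  shows "transpose A = A"
proof -
  have on: "orthonormal_basis B" using assms by (simp add: eigenbasis_def)
  have "x \<bullet> (A *v y) = y \<bullet> (A *v x)" for x y
    using eigenbasis_inner_power[OF assms, of x 1 y] eigenbasis_inner_power[OF assms, of y 1 x]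
    by (simp add: mult.assoc mult.commute mult.left_commute)
  then have "(transpose A *v x) \<bullet> y = (A *v x) \<bullet> y" for x y
    by (metis dot_lmul_matrix inner_commute transpose_matrix_vector)
  then have "transpose A *v x = A *v x" for x
    using vector_eq_rdot by blast
  then show ?thesis by (simp add: matrix_eq)
qed

lemma trace_exp_eigenbasis:
  assumes "eigenbasis A B \<nu>"
  shows "trace_exp A = (\<Sum>b\<in>B. exp (\<nu> b))"
proof -
  have "trace_exp A = (\<Sum>b\<in>B. quad_exp A b)"
    using assms by (intro trace_exp_orthonormal_basis[OF eigenbasis_symmetric]) (auto simp: eigenbasis_def)
  then show ?thesis by (simp add: quad_exp_eigenvector[OF assms])
qed

lemma quad_exp_nonneg:
  assumes "transpose A = A"
  shows "0 \<le> quad_exp A x"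
proof -
  obtain B \<nu> where "eigenbasis A B \<nu>" using symmetric_eigenbasis[OF assms] .
  then show ?thesis by (simp add: quad_exp_eigenbasis sum_nonneg)
qed

lemma trace_exp_nonneg: "transpose A = A \<Longrightarrow> 0 \<le> trace_exp A"
  unfolding trace_exp_def by (intro sum_nonneg quad_exp_nonneg)

lemma quad_exp_scaleR:
  assumes sym: "transpose A = A"
  shows "quad_exp A (c *\<^sub>R x) = c\<^sup>2 * quad_exp A x"
proof -
  obtain B \<nu> where "eigenbasis A B \<nu>" using symmetric_eigenbasis[OF sym] .
  then show ?thesis
    by (simp add: quad_exp_eigenbasis sum_distrib_left power_mult_distrib mult_ac)
qed

lemma transpose_add: "transpose (A + B) = transpose A + transpose (B :: real^'m^'n)"
  by (simp add: transpose_def vec_eq_iff)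

section \<open>The first-order convexity inequality for the trace exponential\<close>

text \<open>The left side is tr(e^A) + tr(Z e^A). For a unit vector \<open>b\<close> the numbers
  \<open>(b \<bullet> c)\<^sup>2\<close> are weights on the spectrum of \<open>A + Z\<close> with
  mean \<open>\<nu> b + b \<bullet> (Z *v b)\<close>; averaging the tangent line of
  \<open>exp\<close> at \<open>\<nu> b\<close> over them gives the bound for
  \<open>b\<close>.\<close>

lemma trace_exp_tangent:
  assumes B: "eigenbasis A B \<nu>" and Z: "transpose Z = Z"
  shows "(\<Sum>b\<in>B. exp (\<nu> b) * (1 + b \<bullet> (Z *v b))) \<le> trace_exp (A + Z)"
proof -
  have sym: "transpose (A + Z) = A + Z"
    by (simp add: transpose_add Z eigenbasis_symmetric[OF B])
  have onB: "orthonormal_basis B" using B by (simp add: eigenbasis_def)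
  obtain C \<mu> where C: "eigenbasis (A + Z) C \<mu>" using symmetric_eigenbasis[OF sym] .
  have onC: "orthonormal_basis C" using C by (simp add: eigenbasis_def)
  have "exp (\<nu> b) * (1 + b \<bullet> (Z *v b)) \<le> quad_exp (A + Z) b" if b: "b \<in> B" for b
  proof -
    have nb: "norm b = 1" using onB b by (simp add: orthonormal_basis_def)
    then have S1: "(\<Sum>c\<in>C. (b \<bullet> c)\<^sup>2) = 1"
      using orthonormal_basis_norm[OF onC, of b] by simp
    have bb: "b \<bullet> b = 1" using nb by (simp add: dot_square_norm)
    have "b \<bullet> (Z *v b) = b \<bullet> ((A + Z) *v b) - \<nu> b"
      using B b bb by (simp add: eigenbasis_def matrix_vector_mult_add_rdistrib inner_add_right)
    also have "\<dots> = (\<Sum>c\<in>C. (\<mu> c - \<nu> b) * (b \<bullet> c)\<^sup>2)"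
      using S1 by (simp add: eigenbasis_inner[OF C] left_diff_distrib sum_subtractf flip: sum_distrib_left)
    finally have "exp (\<nu> b) * (1 + b \<bullet> (Z *v b))
        = exp (\<nu> b) * ((\<Sum>c\<in>C. (b \<bullet> c)\<^sup>2) + (\<Sum>c\<in>C. (\<mu> c - \<nu> b) * (b \<bullet> c)\<^sup>2))"
      using S1 by simp
    also have "\<dots> = (\<Sum>c\<in>C. (exp (\<nu> b) * (1 + (\<mu> c - \<nu> b))) * (b \<bullet> c)\<^sup>2)"
      by (simp only: sum.distrib[symmetric] sum_distrib_left distrib_right distrib_left mult_1_left mult_1_right mult.assoc)
    also have "\<dots> \<le> (\<Sum>c\<in>C. exp (\<mu> c) * (b \<bullet> c)\<^sup>2)"
    proof (intro sum_mono mult_right_mono)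
      fix c
      have "exp (\<nu> b) * (1 + (\<mu> c - \<nu> b)) \<le> exp (\<nu> b) * exp (\<mu> c - \<nu> b)"
        using exp_ge_add_one_self by (intro mult_left_mono) auto
      then show "exp (\<nu> b) * (1 + (\<mu> c - \<nu> b)) \<le> exp (\<mu> c)" by (simp flip: exp_add)
    qed simp
    finally show ?thesis by (simp add: quad_exp_eigenbasis[OF C])
  qed
  then show ?thesis
    unfolding trace_exp_orthonormal_basis[OF sym onB] by (intro sum_mono)
qed

lemma outer_product_mult: "outer_product x y *v v = (y \<bullet> v) *\<^sub>R x"
  by (simp add: outer_product_def matrix_vector_mult_def vec_eq_iff inner_vec_def sum_distrib_left
      sum_distrib_right mult_ac)

lemma transpose_outer_product: "transpose (outer_product x x) = outer_product x x"
  by (simp add: outer_product_def transpose_def vec_eq_iff mult.commute)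

lemma transpose_scaleR: "transpose A = A \<Longrightarrow> transpose (c *\<^sub>R A) = c *\<^sub>R (A :: real^'m^'m)"
  by (simp add: transpose_scalar)

lemma trace_exp_tangent_outer:
  assumes A: "transpose A = A"
  shows "trace_exp A + c * quad_exp A p \<le> trace_exp (A + c *\<^sub>R outer_product p p)"
proof -
  obtain B \<nu> where B: "eigenbasis A B \<nu>" using symmetric_eigenbasis[OF A] .
  have "trace_exp A + c * quad_exp A p
      = (\<Sum>b\<in>B. exp (\<nu> b) * (1 + b \<bullet> ((c *\<^sub>R outer_product p p) *v b)))"
    by (simp add: trace_exp_eigenbasis[OF B] quad_exp_eigenbasis[OF B] outer_product_mult
        scaleR_matrix_vector_assoc[symmetric] distrib_left sum.distrib sum_distrib_left
        power2_eq_square inner_commute mult_ac)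
  also have "\<dots> \<le> trace_exp (A + c *\<^sub>R outer_product p p)"
    by (intro trace_exp_tangent B transpose_scaleR transpose_outer_product)
  finally show ?thesis .
qed

section \<open>Growth of the quadratic form of the exponential under rank-one updates\<close>

text \<open>The double sum of \<open>w x * w y * ((f x - f y) * (g x - g y))\<close> is twice the
  covariance of \<open>f\<close> and \<open>g\<close> under the weights \<open>w\<close>.\<close>

lemma chebyshev_sum_weighted:
  fixes w f g :: "'a \<Rightarrow> real"
  assumes w: "\<And>x. x \<in> S \<Longrightarrow> 0 \<le> w x" "sum w S = 1"
    and fg: "\<And>x y. x \<in> S \<Longrightarrow> y \<in> S \<Longrightarrow> 0 \<le> (f x - f y) * (g x - g y)"
  shows "(\<Sum>x\<in>S. w x * f x) * (\<Sum>x\<in>S. w x * g x) \<le> (\<Sum>x\<in>S. w x * (f x * g x))"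
proof -
  have "0 \<le> (\<Sum>x\<in>S. \<Sum>y\<in>S. w x * w y * ((f x - f y) * (g x - g y)))"
    using w(1) fg by (intro sum_nonneg mult_nonneg_nonneg[OF mult_nonneg_nonneg])
  also have "\<dots> = (\<Sum>x\<in>S. \<Sum>y\<in>S. (w x * (f x * g x)) * w y) + (\<Sum>x\<in>S. \<Sum>y\<in>S. w x * (w y * (f y * g y)))
      - (\<Sum>x\<in>S. \<Sum>y\<in>S. (w x * f x) * (w y * g y)) - (\<Sum>x\<in>S. \<Sum>y\<in>S. (w x * g x) * (w y * f y))"
    by (simp add: sum.distrib sum_subtractf algebra_simps)
  also have "\<dots> = 2 * (\<Sum>x\<in>S. w x * (f x * g x)) - 2 * ((\<Sum>x\<in>S. w x * f x) * (\<Sum>x\<in>S. w x * g x))"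
    unfolding sum_product[symmetric] w(2) by simp
  finally show ?thesis by simp
qed

text \<open>Both powers are nondecreasing on the nonnegative reals, hence similarly ordered, as
  Chebyshev's inequality requires.\<close>

lemma mono_product_nonneg:
  fixes x y :: real
  assumes "0 \<le> x" "0 \<le> y" "0 \<le> h"
  shows "0 \<le> (x ^ i - y ^ i) * ((x + h) ^ k - (y + h) ^ k)"
proof (cases "x \<le> y")
  case True
  then have "x ^ i \<le> y ^ i" "(x + h) ^ k \<le> (y + h) ^ k" using assms by (auto intro: power_mono)
  then show ?thesis by (intro mult_nonpos_nonpos) auto
next
  case False
  then have "y ^ i \<le> x ^ i" "(y + h) ^ k \<le> (x + h) ^ k" using assms by (auto intro: power_mono)
  then show ?thesis by (intro mult_nonneg_nonneg) auto
qed

text \<open>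
  Expanding \<open>(A + h p p\<^sup>T)\<^sup>k\<close> into words, every word contributes a product of moments of the
  spectral distribution of \<open>A\<close> in the state \<open>p\<close>; Chebyshev's inequality merges them into one.
\<close>

lemma rank_one_update_power_le:
  assumes B: "eigenbasis A B \<nu>" and \<nu>: "\<And>b. b \<in> B \<Longrightarrow> 0 \<le> \<nu> b"
    and p: "norm p = 1" and h: "0 \<le> h"
  shows "p \<bullet> (((*v) A ^^ i) (((*v) (A + h *\<^sub>R outer_product p p) ^^ k) p))
       \<le> (\<Sum>b\<in>B. (p \<bullet> b)\<^sup>2 * (\<nu> b ^ i * (\<nu> b + h) ^ k))"
\<comment> \<open>Peeling off one factor \<open>A + h p p\<^sup>T\<close> leaves either another
  \<open>A\<close>, absorbed by raising \<open>i\<close>, or a rank-one term that splits the word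
  into two moments. The hypothesis is thus used at \<open>Suc i\<close> and at 0.\<close>
proof (induction k arbitrary: i)
  case 0
  show ?case
    by (simp add: eigenbasis_inner_power[OF B] power2_eq_square mult_ac)
next
  case (Suc k)
  have onB: "orthonormal_basis B" using B by (simp add: eigenbasis_def)
  let ?v = "((*v) (A + h *\<^sub>R outer_product p p) ^^ k) p"
  let ?a = "\<Sum>b\<in>B. (p \<bullet> b)\<^sup>2 * \<nu> b ^ i"
  have lin: "linear ((*v) A ^^ i)"
  proof (induction i)
    case (Suc i)
    then show ?case using linear_compose[OF Suc matrix_vector_mul_linear[of A]] by (simp add: comp_def)
  qed (simp add: linear_iff)
  have pi: "p \<bullet> (((*v) A ^^ i) p) = ?a"
    by (simp add: eigenbasis_inner_power[OF B] power2_eq_square mult_ac)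
  have a0: "0 \<le> ?a" using \<nu> by (intro sum_nonneg) auto
  have "p \<bullet> (((*v) A ^^ i) (((*v) (A + h *\<^sub>R outer_product p p) ^^ Suc k) p))
      = p \<bullet> (((*v) A ^^ i) (A *v ?v + (h * (p \<bullet> ?v)) *\<^sub>R p))"
    by (simp add: matrix_vector_mult_add_rdistrib scaleR_matrix_vector_assoc[symmetric] outer_product_mult)
  also have "\<dots> = p \<bullet> (((*v) A ^^ Suc i) ?v) + h * (p \<bullet> ?v) * ?a"
    by (simp add: linear_add[OF lin] linear_scale[OF lin] inner_add_right pi funpow_swap1)
  also have "\<dots> \<le> (\<Sum>b\<in>B. (p \<bullet> b)\<^sup>2 * (\<nu> b ^ Suc i * (\<nu> b + h) ^ k))
       + h * (\<Sum>b\<in>B. (p \<bullet> b)\<^sup>2 * (\<nu> b + h) ^ k) * ?a"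
    using Suc[of "Suc i"] Suc[of 0] a0 h
    by (intro add_mono mult_right_mono mult_left_mono) auto
  also have "\<dots> \<le> (\<Sum>b\<in>B. (p \<bullet> b)\<^sup>2 * (\<nu> b ^ Suc i * (\<nu> b + h) ^ k))
      + h * (\<Sum>b\<in>B. (p \<bullet> b)\<^sup>2 * (\<nu> b ^ i * (\<nu> b + h) ^ k))"
  proof -
    have "?a * (\<Sum>b\<in>B. (p \<bullet> b)\<^sup>2 * (\<nu> b + h) ^ k) \<le> (\<Sum>b\<in>B. (p \<bullet> b)\<^sup>2 * (\<nu> b ^ i * (\<nu> b + h) ^ k))"
      using orthonormal_basis_norm[OF onB, of p] p
      by (intro chebyshev_sum_weighted mono_product_nonneg \<nu> h) auto
    from mult_left_mono[OF this h] show ?thesis by (simp only: mult_ac add_left_mono)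
  qed
  also have "\<dots> = (\<Sum>b\<in>B. (p \<bullet> b)\<^sup>2 * (\<nu> b ^ i * (\<nu> b + h) ^ Suc k))"
    by (simp add: sum_distrib_left algebra_simps sum.distrib)
  finally show ?case .
qed

lemma eigenbasis_shift:
  assumes "eigenbasis A B \<nu>"
  shows "eigenbasis (A + s *\<^sub>R mat 1) B (\<lambda>b. \<nu> b + s)"
  using assms by (simp add: eigenbasis_def matrix_vector_mult_add_rdistrib
      scaleR_matrix_vector_assoc[symmetric] scaleR_add_left)

lemma quad_exp_shift:
  assumes "transpose A = A"
  shows "quad_exp (A + s *\<^sub>R mat 1) x = exp s * quad_exp A x"
proof -
  obtain B \<nu> where B: "eigenbasis A B \<nu>" using symmetric_eigenbasis[OF assms] .
  show ?thesis
    by (simp add: quad_exp_eigenbasis[OF B] quad_exp_eigenbasis[OF eigenbasis_shift[OF B]]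
        exp_add sum_distrib_left mult_ac)
qed

text \<open>A multiple of the identity is added first to make the eigenvalues nonnegative, as
  \<open>rank_one_update_power_le\<close> requires; this scales both sides by the same factor. The
  power series are then compared term by term.\<close>

lemma quad_exp_rank_one_update_le:
  assumes A: "transpose A = A" and p: "norm p = 1" and h: "0 \<le> h"
  shows "quad_exp (A + h *\<^sub>R outer_product p p) p \<le> exp h * quad_exp A p"
proof -
  obtain B0 \<nu>0 where B0: "eigenbasis A B0 \<nu>0" using symmetric_eigenbasis[OF A] .
  define s where "s = (\<Sum>b\<in>B0. \<bar>\<nu>0 b\<bar>)"
  define \<nu> where "\<nu> b = \<nu>0 b + s" for b
  let ?A = "A + s *\<^sub>R mat 1"
  have B: "eigenbasis ?A B0 \<nu>" unfolding \<nu>_def by (rule eigenbasis_shift[OF B0])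
  have "finite B0" using B0 by (simp add: eigenbasis_def orthonormal_basis_finite)
  then have \<nu>: "0 \<le> \<nu> b" if "b \<in> B0" for b
    using member_le_sum[of b B0 "\<lambda>b. \<bar>\<nu>0 b\<bar>"] that by (simp add: \<nu>_def s_def)
  have sym: "transpose (A + h *\<^sub>R outer_product p p) = A + h *\<^sub>R outer_product p p"
    by (simp add: transpose_add A transpose_scaleR transpose_outer_product)
  have eq: "?A + h *\<^sub>R outer_product p p = (A + h *\<^sub>R outer_product p p) + s *\<^sub>R mat 1"
    by simp
  have symA: "transpose (?A + h *\<^sub>R outer_product p p) = ?A + h *\<^sub>R outer_product p p"
    unfolding eq by (subst transpose_add) (simp add: sym transpose_scaleR)
  obtain C \<mu> where C: "eigenbasis (?A + h *\<^sub>R outer_product p p) C \<mu>"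
    using symmetric_eigenbasis[OF symA] .
  have "quad_exp (?A + h *\<^sub>R outer_product p p) p \<le> (\<Sum>b\<in>B0. exp (\<nu> b + h) * (p \<bullet> b)\<^sup>2)"
  proof (rule sums_le)
    show "(\<lambda>k. (p \<bullet> (((*v) (?A + h *\<^sub>R outer_product p p) ^^ k) p)) / fact k) sums
        quad_exp (?A + h *\<^sub>R outer_product p p) p"
      using quad_exp_sums[OF C, of p] by (simp add: quad_exp_eigenbasis[OF C])
    show "(\<lambda>k. \<Sum>b\<in>B0. ((\<nu> b + h) ^ k /\<^sub>R fact k) * (p \<bullet> b)\<^sup>2) sums (\<Sum>b\<in>B0. exp (\<nu> b + h) * (p \<bullet> b)\<^sup>2)"
      by (intro sums_sum sums_mult2 exp_converges)
    show "(p \<bullet> (((*v) (?A + h *\<^sub>R outer_product p p) ^^ k) p)) / fact k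
         \<le> (\<Sum>b\<in>B0. ((\<nu> b + h) ^ k /\<^sub>R fact k) * (p \<bullet> b)\<^sup>2)" for k
      using divide_right_mono[OF rank_one_update_power_le[OF B \<nu> p h, of 0 k], of "fact k"]
      by (simp add: sum_divide_distrib field_simps)
  qed
  also have "\<dots> = exp h * quad_exp ?A p"
    by (simp add: quad_exp_eigenbasis[OF B] exp_add sum_distrib_left mult_ac)
  finally show ?thesis
    unfolding eq quad_exp_shift[OF A] quad_exp_shift[OF sym] by simp
qed

section \<open>From tangent and growth bounds to exponential bounds\<close>

text \<open>A substitute for a sign condition on the derivative: over \<open>Suc N\<close> equal
  steps the errors add up to \<open>K h\<^sup>2 / Suc N\<close>, which tends to 0.\<close>

lemma le_by_quadratic_increments:
  fixes q :: "real \<Rightarrow> real"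
  assumes q: "\<And>s \<tau>. 0 \<le> s \<Longrightarrow> 0 \<le> \<tau> \<Longrightarrow> s + \<tau> \<le> h \<Longrightarrow> q (s + \<tau>) \<le> q s + K * \<tau>\<^sup>2"
    and h: "0 \<le> h"
  shows "q h \<le> q 0"
proof -
  have "q h \<le> q 0 + K * h\<^sup>2 * inverse (real (Suc N))" for N
  proof -
    define d where "d = h / real (Suc N)"
    have d: "0 \<le> d" "real (Suc N) * d = h" using h by (auto simp: d_def)
    have "q (real k * d) \<le> q 0 + real k * (K * d\<^sup>2)" if "k \<le> Suc N" for k
      using that
    proof (induction k)
      case (Suc k)
      have "real k * d + d = real (Suc k) * d" by (simp add: algebra_simps)
      moreover have "real (Suc k) * d \<le> h"
        unfolding d(2)[symmetric] using Suc.prems d(1) by (intro mult_right_mono) auto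
      ultimately have "q (real (Suc k) * d) \<le> q (real k * d) + K * d\<^sup>2"
        using q[of "real k * d" d] d(1) by simp
      then show ?case using Suc by (simp add: algebra_simps)
    qed simp
    from this[of "Suc N"] have "q h \<le> q 0 + real (Suc N) * (K * d\<^sup>2)" using d(2) by simp
    also have "real (Suc N) * (K * d\<^sup>2) = K * (real (Suc N) * d) * d"
      by (simp add: power2_eq_square del: of_nat_Suc)
    also have "\<dots> = K * h\<^sup>2 * inverse (real (Suc N))"
      unfolding d(2) by (simp add: d_def power2_eq_square divide_inverse del: of_nat_Suc)
    finally show ?thesis .
  qed
  moreover have "(\<lambda>N. q 0 + K * h\<^sup>2 * inverse (real (Suc N))) \<longlonglongrightarrow> q 0 + K * h\<^sup>2 * 0"
    by (intro tendsto_intros LIMSEQ_inverse_real_of_nat)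
  ultimately show ?thesis
    by (intro LIMSEQ_le_const[where X = "\<lambda>N. q 0 + K * h\<^sup>2 * inverse (real (Suc N))"]) auto
qed

text \<open>Follows from \<open>1 + x \<le> exp x\<close> and
  \<open>(1 + x) (1 - x + x\<^sup>2) = 1 + x\<^sup>3\<close>.\<close>

lemma exp_times_one_minus_le:
  fixes x :: real
  assumes "0 \<le> x"
  shows "1 \<le> exp x * (1 - x + x\<^sup>2)"
proof -
  have "1 \<le> (1 + x) * (1 - x + x\<^sup>2)"
    using assms by (simp add: algebra_simps power2_eq_square)
  also have "\<dots> \<le> exp x * (1 - x + x\<^sup>2)"
  proof (intro mult_right_mono exp_ge_add_one_self)
    have "0 \<le> (1 - x)\<^sup>2 + x" using assms by simp
    then show "0 \<le> 1 - x + x\<^sup>2" using zero_le_power2[of "x - 1/2"] by (simp add: power2_eq_square algebra_simps)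
  qed
  finally show ?thesis .
qed

text \<open>A derivative-free integration of \<open>f' = g\<close> with
  \<open>g s \<le> exp s * g 0\<close>: on each step the increment of \<open>f\<close> exceeds that
  of \<open>exp s * g 0\<close> by at most a quadratic error.\<close>

lemma le_exp_growth_above:
  fixes f g :: "real \<Rightarrow> real"
  assumes tangent: "\<And>s \<tau>. f s + \<tau> * g s \<le> f (s + \<tau>)"
    and growth: "\<And>s \<tau>. 0 \<le> \<tau> \<Longrightarrow> g (s + \<tau>) \<le> exp \<tau> * g s"
    and nonneg: "0 \<le> g 0" and c: "0 \<le> c"
  shows "f c \<le> f 0 + (exp c - 1) * g 0"
proof -
  define q where "q s = f s - (exp s - 1) * g 0" for s
  have "q c \<le> q 0"
  proof (rule le_by_quadratic_increments[OF _ c])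
    fix s \<tau> :: real
    assume s: "0 \<le> s" "0 \<le> \<tau>" "s + \<tau> \<le> c"
    have "g (s + \<tau>) \<le> exp (s + \<tau>) * g 0"
      using growth[of "s + \<tau>" 0] s by simp
    \<comment> \<open>The tangent is taken at the right endpoint and followed backwards, which turns
      it into an upper bound for the increment.\<close>
    then have "f (s + \<tau>) - f s \<le> \<tau> * (exp (s + \<tau>) * g 0)"
      using tangent[of "s + \<tau>" "- \<tau>"] mult_left_mono[of "g (s + \<tau>)" _ \<tau>] s(2) by fastforce
    moreover have "\<tau> * exp (s + \<tau>) - (exp (s + \<tau>) - exp s) \<le> exp c * \<tau>\<^sup>2"
    proof -
      have "exp s * 1 \<le> exp s * (exp \<tau> * (1 - \<tau> + \<tau>\<^sup>2))"
        using exp_times_one_minus_le[OF s(2)] by (intro mult_left_mono) auto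
      moreover have "exp (s + \<tau>) * \<tau>\<^sup>2 \<le> exp c * \<tau>\<^sup>2" using s by (intro mult_right_mono) auto
      ultimately show ?thesis by (simp add: exp_add algebra_simps)
    qed
    from mult_right_mono[OF this nonneg]
    have "\<tau> * (exp (s + \<tau>) * g 0) \<le> (exp (s + \<tau>) - exp s) * g 0 + exp c * g 0 * \<tau>\<^sup>2"
      by (simp add: algebra_simps)
    ultimately show "q (s + \<tau>) \<le> q s + (exp c * g 0) * \<tau>\<^sup>2"
      by (simp add: q_def algebra_simps)
  qed
  then show ?thesis by (simp add: q_def)
qed

lemma le_exp_growth_below:
  fixes f g :: "real \<Rightarrow> real"
  assumes tangent: "\<And>s \<tau>. f s + \<tau> * g s \<le> f (s + \<tau>)"
    and growth: "\<And>s \<tau>. 0 \<le> \<tau> \<Longrightarrow> g (s + \<tau>) \<le> exp \<tau> * g s"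
    and nonneg: "0 \<le> g 0" and c: "0 \<le> c"
  shows "f (- c) \<le> f 0 + (exp (- c) - 1) * g 0"
proof -
  define q where "q s = f (- s) - (exp (- s) - 1) * g 0" for s
  have "q c \<le> q 0"
  proof (rule le_by_quadratic_increments[OF _ c])
    fix s \<tau> :: real
    assume s: "0 \<le> s" "0 \<le> \<tau>" "s + \<tau> \<le> c"
    \<comment> \<open>Growth from \<open>- s - \<tau>\<close> up to 0 bounds \<open>g\<close> from
      below on the negative axis; hence \<open>f\<close> falls at least at the required rate when
      moving left.\<close>
    have "exp (- s - \<tau>) * g 0 \<le> exp (- s - \<tau>) * (exp (s + \<tau>) * g (- s - \<tau>))"
      using growth[of "s + \<tau>" "- s - \<tau>"] s by (intro mult_left_mono) auto
    then have "exp (- s - \<tau>) * g 0 \<le> g (- s - \<tau>)" by (simp add: mult.assoc[symmetric] flip: exp_add)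
    then have "f (- s - \<tau>) + \<tau> * (exp (- s - \<tau>) * g 0) \<le> f (- s)"
      using tangent[of "- s - \<tau>" "\<tau>"] mult_left_mono[of _ "g (- s - \<tau>)" \<tau>] s(2) by fastforce
    moreover have "exp (- s) - exp (- s - \<tau>) \<le> \<tau> * exp (- s - \<tau>) + \<tau>\<^sup>2"
    proof -
      have "exp (- s - \<tau>) = exp (- s) * exp (- \<tau>)" by (simp flip: exp_add)
      then have "exp (- s) - exp (- s - \<tau>) - \<tau> * exp (- s - \<tau>) = exp (- s) * (1 - (1 + \<tau>) * exp (- \<tau>))"
        by (simp add: algebra_simps)
      also have "\<dots> \<le> 1 * (1 - (1 + \<tau>) * (1 - \<tau>))"
      proof (intro mult_mono)
        have "(1 + \<tau>) * exp (- \<tau>) \<le> exp \<tau> * exp (- \<tau>)" by (intro mult_right_mono exp_ge_add_one_self) auto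
        then show "0 \<le> 1 - (1 + \<tau>) * exp (- \<tau>)" by (simp flip: exp_add)
        have "(1 + \<tau>) * (1 - \<tau>) \<le> (1 + \<tau>) * exp (- \<tau>)"
          using exp_ge_add_one_self[of "- \<tau>"] s by (intro mult_left_mono) auto
        then show "1 - (1 + \<tau>) * exp (- \<tau>) \<le> 1 - (1 + \<tau>) * (1 - \<tau>)" by simp
      qed (use s in auto)
      finally show ?thesis by (simp add: algebra_simps power2_eq_square)
    qed
    from mult_right_mono[OF this nonneg]
    have "(exp (- s) - exp (- s - \<tau>)) * g 0 \<le> \<tau> * (exp (- s - \<tau>) * g 0) + g 0 * \<tau>\<^sup>2"
      by (simp add: algebra_simps)
    moreover have "- (s + \<tau>) = - s - \<tau>" by simp
    ultimately show "q (s + \<tau>) \<le> q s + g 0 * \<tau>\<^sup>2"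
      unfolding q_def by (simp add: left_diff_distrib)
  qed
  then show ?thesis by (simp add: q_def)
qed

text \<open>
  The Golden-Thompson inequality for a rank-one second matrix. With \<open>f(c) = tr exp(A + c p p\<^sup>T)\<close> and
  \<open>g(c) = p\<^sup>T exp(A + c p p\<^sup>T) p\<close> one has \<open>f' = g\<close> and \<open>0 \<le> g' \<le> g\<close>, which is used here only in the form
  of the tangent bound for \<open>f\<close> and the growth bound for \<open>g\<close>.
\<close>

lemma trace_exp_rank_one_unit:
  assumes A: "transpose A = A" and p: "norm p = 1"
  shows "trace_exp (A + c *\<^sub>R outer_product p p) \<le> trace_exp A + (exp c - 1) * quad_exp A p"
proof -
  define P where "P = outer_product p p"
  have sym: "transpose (A + s *\<^sub>R P) = A + s *\<^sub>R P" for s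
    by (simp add: P_def transpose_add A transpose_scaleR transpose_outer_product)
  have tangent: "trace_exp (A + s *\<^sub>R P) + \<tau> * quad_exp (A + s *\<^sub>R P) p \<le> trace_exp (A + (s + \<tau>) *\<^sub>R P)" for s \<tau>
    using trace_exp_tangent_outer[OF sym, of s \<tau> p] by (simp add: P_def scaleR_add_left add.assoc)
  have growth: "quad_exp (A + (s + \<tau>) *\<^sub>R P) p \<le> exp \<tau> * quad_exp (A + s *\<^sub>R P) p" if "0 \<le> \<tau>" for s \<tau>
    using quad_exp_rank_one_update_le[OF sym p that, of s] by (simp add: P_def scaleR_add_left add.assoc)
  have nonneg: "0 \<le> quad_exp (A + 0 *\<^sub>R P) p" using quad_exp_nonneg[OF A] by simp
  show ?thesis
  proof (cases "0 \<le> c")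
    case True
    from le_exp_growth_above[OF tangent growth nonneg this] show ?thesis by (simp add: P_def)
  next
    case False
    then have "0 \<le> - c" by simp
    from le_exp_growth_below[OF tangent growth nonneg this] show ?thesis by (simp add: P_def)
  qed
qed

lemma outer_product_scaleR: "outer_product (c *\<^sub>R x) (d *\<^sub>R y) = (c * d) *\<^sub>R outer_product x y"
  by (simp add: outer_product_def vec_eq_iff)

text \<open>After normalising \<open>y\<close>, the hypothesis \<open>ab\<close> replaces the
  exponential factor by a multiple of the squared norm. The bound becomes linear in
  \<open>outer_product y y\<close>, so its expectation depends on the second moment only.\<close>

lemma trace_exp_rank_one:
  fixes A :: "real^'m^'m"
  assumes A: "transpose A = A" and ab: "exp (a * (norm y)\<^sup>2) - 1 \<le> b * (norm y)\<^sup>2"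
  shows "trace_exp (A + a *\<^sub>R outer_product y y) \<le> trace_exp A + b * quad_exp A y"
proof (cases "y = 0")
  case True
  have "outer_product (0 :: real^'m) (0 :: real^'m) = 0" by (simp add: outer_product_def vec_eq_iff)
  moreover have "quad_exp A 0 = 0" using quad_exp_scaleR[OF A, of 0 0] by simp
  ultimately show ?thesis using True by simp
next
  case False
  define p where "p = (1 / norm y) *\<^sub>R y"
  have p: "norm p = 1" and y: "y = norm y *\<^sub>R p" using False by (auto simp: p_def)
  have "outer_product y y = (norm y)\<^sup>2 *\<^sub>R outer_product p p"
    by (subst y, subst (2) y, subst outer_product_scaleR) (simp add: power2_eq_square)
  then have "trace_exp (A + a *\<^sub>R outer_product y y)
      \<le> trace_exp A + (exp (a * (norm y)\<^sup>2) - 1) * quad_exp A p"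
    using trace_exp_rank_one_unit[OF A p] by simp
  also have "\<dots> \<le> trace_exp A + b * (norm y)\<^sup>2 * quad_exp A p"
    using ab quad_exp_nonneg[OF A] by (intro add_left_mono mult_right_mono)
  also have "\<dots> = trace_exp A + b * quad_exp A y"
    using quad_exp_scaleR[OF A, of "norm y" p] y by simp
  finally show ?thesis .
qed

section \<open>Spectral norm, intrinsic dimension and measurability\<close>

lemma continuous_on_matrix_power_apply: "continuous_on UNIV (\<lambda>A :: real^'m^'m. ((*v) A ^^ k) x)"
proof (induction k)
  case (Suc k)
  have "continuous_on UNIV (\<lambda>A :: real^'m^'m. \<chi> i. \<Sum>j\<in>UNIV. A $ i $ j * (((*v) A ^^ k) x) $ j)"
    by (intro continuous_intros Suc)
  then show ?case by (simp add: matrix_vector_mult_def[abs_def])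
qed simp

text \<open>The terms of the defining series are continuous in the matrix, and limits of measurable
  functions are measurable.\<close>

lemma borel_measurable_trace_exp: "(trace_exp :: real^'m^'m \<Rightarrow> real) \<in> borel_measurable borel"
proof -
  have [measurable]: "(\<lambda>A :: real^'m^'m. ((*v) A ^^ k) x) \<in> borel_measurable borel" for k x
    by (intro borel_measurable_continuous_onI continuous_on_matrix_power_apply)
  show ?thesis
    unfolding trace_exp_def[abs_def] quad_exp_def by measurable
qed

lemma borel_measurable_outer_product: "(\<lambda>x :: real^'m. outer_product x x) \<in> borel_measurable borel"
  unfolding outer_product_def by (intro borel_measurable_continuous_onI continuous_intros)

lemma spectral_norm_le_iff: "spectral_norm A \<le> K \<longleftrightarrow> (\<forall>x. norm (A *v x) \<le> K * norm x)"
proof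
  assume "spectral_norm A \<le> K"
  then show "\<forall>x. norm (A *v x) \<le> K * norm x"
    unfolding spectral_norm_def
    by (meson matrix_vector_mul_bounded_linear mult_right_mono norm_ge_zero onorm order_trans)
qed (auto simp: spectral_norm_def intro: onorm_le)

text \<open>Sublevel sets are closed, being intersections over \<open>x\<close> of closed conditions
  on the matrix.\<close>

lemma borel_measurable_spectral_norm: "(spectral_norm :: real^'n^'m \<Rightarrow> real) \<in> borel_measurable borel"
  unfolding borel_measurable_iff_le
proof
  fix K :: real
  have "closed {A :: real^'n^'m. norm (A *v x) \<le> K * norm x}" for x
    unfolding matrix_vector_mult_def by (intro closed_Collect_le continuous_intros)
  then have "closed {A :: real^'n^'m. spectral_norm A \<le> K}"
    unfolding spectral_norm_le_iff by (rule closed_Collect_all)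
  then show "{A \<in> space borel. (spectral_norm A :: real) \<le> K} \<in> sets (borel :: (real^'n^'m) measure)"
    by simp
qed

lemma norm_outer_product: "norm (outer_product x y) = norm x * norm y"
proof -
  have "outer_product x y = (\<chi> i. (x $ i) *\<^sub>R y)"
    by (simp add: outer_product_def vec_eq_iff)
  then show ?thesis
    by (simp add: norm_vec_def[of x] norm_vec_def[of "\<chi> i. (x $ i) *\<^sub>R y"] L2_set_left_distrib)
qed

lemma spectral_norm_pos:
  assumes "A \<noteq> 0"
  shows "0 < spectral_norm A"
proof (rule ccontr)
  assume "\<not> 0 < spectral_norm A"
  then have "A *v x = 0" for x using spectral_norm_le_iff[of A 0] by (simp add: not_less)
  then show False using assms by (simp add: matrix_eq)
qed

lemma eigenvalue_le_spectral_norm: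
  assumes "eigenbasis A B \<nu>" "b \<in> B"
  shows "\<bar>\<nu> b\<bar> \<le> spectral_norm A"
  using assms spectral_norm_le_iff[of A "spectral_norm A"]
  by (auto simp: eigenbasis_def orthonormal_basis_def dest!: spec[of _ b])

text \<open>If every eigenvalue had modulus at most \<open>t\<close>, Parseval would bound the norm
  of \<open>A *v x\<close> by \<open>t * norm x\<close>.\<close>

lemma spectral_norm_attained:
  assumes B: "eigenbasis A B \<nu>" and less: "t < spectral_norm A"
  obtains b where "b \<in> B" "t < \<bar>\<nu> b\<bar>"
proof -
  have "\<exists>b\<in>B. t < \<bar>\<nu> b\<bar>"
  proof (rule ccontr)
    assume "\<not> (\<exists>b\<in>B. t < \<bar>\<nu> b\<bar>)"
    then have small: "\<bar>\<nu> b\<bar> \<le> t" if "b \<in> B" for b using that by (simp add: not_less)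
    have on: "orthonormal_basis B" using B by (simp add: eigenbasis_def)
    \<comment> \<open>A nonempty basis forces \<open>t\<close> to be nonnegative, which permits
      passing between inequalities and their squares.\<close>
    have "B \<noteq> {}" using orthonormal_basis_norm[OF on, of "axis undefined 1"] by auto
    then have t: "0 \<le> t" using small abs_ge_zero order_trans by blast
    have "norm (A *v x) \<le> t * norm x" for x
    proof -
      have "(A *v x) \<bullet> b = \<nu> b * (x \<bullet> b)" if "b \<in> B" for b
        using symmetric_inner[OF eigenbasis_symmetric[OF B], of x b] B that by (simp add: eigenbasis_def)
      then have "(norm (A *v x))\<^sup>2 = (\<Sum>b\<in>B. (\<nu> b)\<^sup>2 * (x \<bullet> b)\<^sup>2)"
        unfolding orthonormal_basis_norm[OF on, symmetric] by (simp add: power_mult_distrib)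
      also have "\<dots> \<le> (\<Sum>b\<in>B. t\<^sup>2 * (x \<bullet> b)\<^sup>2)"
        using small t by (intro sum_mono mult_right_mono) (auto simp: abs_le_square_iff[symmetric])
      also have "\<dots> = (t * norm x)\<^sup>2"
        by (simp add: orthonormal_basis_norm[OF on] power_mult_distrib flip: sum_distrib_left)
      finally show ?thesis using t by (simp add: power2_le_iff_abs_le)
    qed
    then show False using less spectral_norm_le_iff[of A t] by simp
  qed
  then show ?thesis using that by blast
qed

section \<open>Trace exponentials, intrinsic dimension and spectral norm\<close>

lemma eigenbasis_scaleR: "eigenbasis A B \<nu> \<Longrightarrow> eigenbasis (c *\<^sub>R A) B (\<lambda>b. c * \<nu> b)"
  by (simp add: eigenbasis_def scaleR_matrix_vector_assoc[symmetric])

lemma trace_exp_zero: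
  fixes B :: "(real^'m) set"
  assumes "orthonormal_basis B"
  shows "trace_exp (0 :: real^'m^'m) = real (card B)"
proof -
  have "eigenbasis (0 :: real^'m^'m) B (\<lambda>_. 0)" using assms by (simp add: eigenbasis_def)
  from trace_exp_eigenbasis[OF this] show ?thesis by simp
qed

lemma sym_psd_eigenvalue_nonneg:
  assumes "sym_psd E" "eigenbasis E B \<nu>" "b \<in> B"
  shows "0 \<le> \<nu> b"
proof -
  have "0 \<le> b \<bullet> (E *v b)" using assms(1) by (simp add: sym_psd_def)
  moreover have "b \<bullet> b = 1"
    using assms orthonormal_basis_inner[of B b b] by (simp add: eigenbasis_def)
  ultimately show ?thesis using assms by (simp add: eigenbasis_def)
qed

lemma trace_eigenbasis:
  assumes "eigenbasis A B \<nu>"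
  shows "trace A = (\<Sum>b\<in>B. \<nu> b)"
proof -
  have on: "orthonormal_basis B" using assms by (simp add: eigenbasis_def)
  show ?thesis
    unfolding trace_orthonormal_basis[OF on] using assms orthonormal_basis_inner[OF on]
    by (intro sum.cong) (auto simp: eigenbasis_def)
qed

lemma intdim_ge_1:
  assumes E: "sym_psd E" "E \<noteq> 0"
  shows "1 \<le> intdim E"
proof -
  obtain B \<nu> where B: "eigenbasis E B \<nu>"
    using symmetric_eigenbasis E unfolding sym_psd_def by blast
  have "spectral_norm E \<le> trace E"
  proof (rule ccontr)
    assume "\<not> spectral_norm E \<le> trace E"
    then obtain b where b: "b \<in> B" "trace E < \<bar>\<nu> b\<bar>"
      using spectral_norm_attained[OF B] by (metis not_le)
    have "finite B" using B by (simp add: eigenbasis_def orthonormal_basis_finite)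
    then have "\<nu> b \<le> (\<Sum>b\<in>B. \<nu> b)"
      using b sym_psd_eigenvalue_nonneg[OF E(1) B] by (intro member_le_sum) auto
    then show False
      using b sym_psd_eigenvalue_nonneg[OF E(1) B b(1)] by (simp add: trace_eigenbasis[OF B])
  qed
  then show ?thesis using spectral_norm_pos[OF E(2)] by (simp add: intdim_def)
qed

text \<open>On the interval from 0 to \<open>spectral_norm E\<close> the graph of
  \<open>exp (c * t)\<close> lies below its chord, and the eigenvalues divided by the spectral norm
  sum to \<open>intdim E\<close>. The ambient dimension enters only as \<open>trace_exp 0\<close>,
  which cancels in the tail bound.\<close>

lemma trace_exp_intdim_le:
  fixes E :: "real^'m^'m"
  assumes E: "sym_psd E" "E \<noteq> 0" and c: "0 \<le> c"
  shows "trace_exp (c *\<^sub>R E) \<le> trace_exp (0 :: real^'m^'m) + intdim E * (exp (c * spectral_norm E) - 1)"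
proof -
  obtain B \<nu> where B: "eigenbasis E B \<nu>"
    using symmetric_eigenbasis E unfolding sym_psd_def by blast
  define v where "v = spectral_norm E"
  have v: "0 < v" unfolding v_def using E by (intro spectral_norm_pos)
  have "exp (c * \<nu> b) \<le> 1 + \<nu> b / v * (exp (c * v) - 1)" if b: "b \<in> B" for b
  proof -
    define t where "t = \<nu> b / v"
    have t: "0 \<le> t" "t \<le> 1" "\<nu> b = t * v"
      using sym_psd_eigenvalue_nonneg[OF E(1) B b] eigenvalue_le_spectral_norm[OF B b] v
      by (auto simp: t_def v_def)
    have "exp ((1 - t) *\<^sub>R 0 + t *\<^sub>R (c * v)) \<le> (1 - t) * exp 0 + t * exp (c * v)"
      using t by (intro convex_onD[OF exp_convex]) auto
    then show ?thesis unfolding t_def[symmetric] using t(3) by (simp add: algebra_simps)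
  qed
  then have "trace_exp (c *\<^sub>R E) \<le> (\<Sum>b\<in>B. 1 + \<nu> b / v * (exp (c * v) - 1))"
    unfolding trace_exp_eigenbasis[OF eigenbasis_scaleR[OF B]] by (intro sum_mono)
  also have "\<dots> = real (card B) + trace E / v * (exp (c * v) - 1)"
    unfolding sum.distrib trace_eigenbasis[OF B] sum_divide_distrib sum_distrib_right by simp
  also have "real (card B) = trace_exp (0 :: real^'m^'m)"
    using B trace_exp_zero[of B] by (simp add: eigenbasis_def)
  finally show ?thesis by (simp add: intdim_def v_def)
qed

lemma trace_exp_add_uminus:
  fixes A :: "real^'m^'m"
  assumes B: "eigenbasis A B \<nu>"
  shows "trace_exp A + trace_exp (- A) = 2 * trace_exp (0 :: real^'m^'m) + (\<Sum>b\<in>B. 2 * (cosh (\<nu> b) - 1))"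
proof -
  have on: "orthonormal_basis B" using B by (simp add: eigenbasis_def)
  have cosh2: "2 * cosh x = exp x + exp (- x)" for x :: real
    by (simp add: cosh_def field_simps)
  have "eigenbasis (- A) B (\<lambda>b. - \<nu> b)" using eigenbasis_scaleR[OF B, of "-1"] by simp
  then have "trace_exp A + trace_exp (- A) = (\<Sum>b\<in>B. 2 + 2 * (cosh (\<nu> b) - 1))"
    by (simp add: trace_exp_eigenbasis[OF B] trace_exp_eigenbasis cosh2 flip: sum.distrib)
  also have "\<dots> = 2 * trace_exp (0 :: real^'m^'m) + (\<Sum>b\<in>B. 2 * (cosh (\<nu> b) - 1))"
    unfolding sum.distrib by (simp add: trace_exp_zero[OF on])
  finally show ?thesis .
qed

lemma trace_exp_add_uminus_ge:
  fixes A :: "real^'m^'m"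
  assumes "transpose A = A"
  shows "2 * trace_exp (0 :: real^'m^'m) \<le> trace_exp A + trace_exp (- A)"
proof -
  obtain B \<nu> where "eigenbasis A B \<nu>" using symmetric_eigenbasis[OF assms] .
  then show ?thesis using cosh_real_ge_1 by (simp add: trace_exp_add_uminus sum_nonneg)
qed

text \<open>A single eigenvalue of modulus above \<open>t\<close> supplies the excess, and the other
  terms are nonnegative. Since \<open>cosh\<close> is even, large positive and negative eigenvalues
  are covered together.\<close>

lemma trace_exp_add_uminus_ge_cosh:
  fixes A :: "real^'m^'m"
  assumes A: "transpose A = A" and t: "0 \<le> t" "t < spectral_norm A"
  shows "2 * trace_exp (0 :: real^'m^'m) + 2 * (cosh t - 1) \<le> trace_exp A + trace_exp (- A)"
proof -
  obtain B \<nu> where B: "eigenbasis A B \<nu>" using symmetric_eigenbasis[OF A] .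
  then have fin: "finite B" by (simp add: eigenbasis_def orthonormal_basis_finite)
  obtain b where b: "b \<in> B" "t < \<bar>\<nu> b\<bar>" using spectral_norm_attained[OF B t(2)] .
  then have "cosh t \<le> cosh \<bar>\<nu> b\<bar>" using t(1) by (subst cosh_real_nonneg_le_iff) auto
  then have "2 * (cosh t - 1) \<le> 2 * (cosh (\<nu> b) - 1)" by simp
  also have "\<dots> \<le> (\<Sum>b\<in>B. 2 * (cosh (\<nu> b) - 1))"
    using b(1) fin cosh_real_ge_1
    by (intro member_le_sum[where f = "\<lambda>b. 2 * (cosh (\<nu> b) - 1)"]) auto
  finally show ?thesis by (simp add: trace_exp_add_uminus[OF B])
qed

section \<open>Trace exponentials of sums of independent rank-one matrices\<close>

text \<open>The joint law is a product measure, so Tonelli's theorem lets \<open>Y\<close> be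
  integrated with \<open>X\<close> frozen.\<close>

lemma (in prob_space) nn_integral_indep_var:
  assumes ind: "indep_var S X T Y" and f: "f \<in> borel_measurable (S \<Otimes>\<^sub>M T)"
  shows "(\<integral>\<^sup>+\<omega>. f (X \<omega>, Y \<omega>) \<partial>M) = (\<integral>\<^sup>+\<omega>. \<integral>\<^sup>+\<omega>'. f (X \<omega>, Y \<omega>') \<partial>M \<partial>M)"
proof -
  note [measurable] = indep_var_rv1[OF ind] indep_var_rv2[OF ind] f
  interpret T: prob_space "distr M T Y" by (rule prob_space_distr) measurable
  have "(\<integral>\<^sup>+\<omega>. f (X \<omega>, Y \<omega>) \<partial>M) = (\<integral>\<^sup>+z. f z \<partial>distr M (S \<Otimes>\<^sub>M T) (\<lambda>\<omega>. (X \<omega>, Y \<omega>)))"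
    by (simp add: nn_integral_distr)
  also have "\<dots> = (\<integral>\<^sup>+z. f z \<partial>(distr M S X \<Otimes>\<^sub>M distr M T Y))"
    using ind by (simp add: indep_var_distribution_eq)
  also have "\<dots> = (\<integral>\<^sup>+x. \<integral>\<^sup>+y. f (x, y) \<partial>distr M T Y \<partial>distr M S X)"
    by (rule T.nn_integral_fst[symmetric]) (simp add: f)
  also have "\<dots> = (\<integral>\<^sup>+\<omega>. \<integral>\<^sup>+y. f (X \<omega>, y) \<partial>distr M T Y \<partial>M)"
    by (simp add: nn_integral_distr)
  also have "\<dots> = (\<integral>\<^sup>+\<omega>. \<integral>\<^sup>+\<omega>'. f (X \<omega>, Y \<omega>') \<partial>M \<partial>M)"
  proof (intro nn_integral_cong)
    fix \<omega> assume "\<omega> \<in> space M"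
    then have "(\<lambda>y. f (X \<omega>, y)) \<in> borel_measurable T"
      by (intro measurable_Pair2[OF f] measurable_space[OF indep_var_rv1[OF ind]])
    then show "(\<integral>\<^sup>+y. f (X \<omega>, y) \<partial>distr M T Y) = (\<integral>\<^sup>+\<omega>'. f (X \<omega>, Y \<omega>') \<partial>M)"
      by (simp add: nn_integral_distr)
  qed
  finally show ?thesis .
qed

context prob_space
begin

text \<open>The quadratic form at \<open>b\<close> is a bounded linear functional of the matrix, so
  it commutes with the integral of the bounded outer product.\<close>

lemma second_moment_quad_form:
  fixes z :: "'a \<Rightarrow> real^'m"
  assumes [measurable]: "random_variable borel z"
    and L: "AE \<omega> in M. norm (z \<omega>) \<le> L"
    and E: "expectation (\<lambda>\<omega>. outer_product (z \<omega>) (z \<omega>)) = E"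
  shows "integrable M (\<lambda>\<omega>. (z \<omega> \<bullet> b)\<^sup>2)" and "expectation (\<lambda>\<omega>. (z \<omega> \<bullet> b)\<^sup>2) = b \<bullet> (E *v b)"
proof -
  have [measurable]: "(\<lambda>\<omega>. outer_product (z \<omega>) (z \<omega>)) \<in> borel_measurable M"
    by (rule measurable_compose[OF _ borel_measurable_outer_product]) measurable
  have int: "integrable M (\<lambda>\<omega>. outer_product (z \<omega>) (z \<omega>))"
  proof (rule integrable_const_bound)
    show "AE \<omega> in M. norm (outer_product (z \<omega>) (z \<omega>)) \<le> L * L"
      using L by eventually_elim (simp add: norm_outer_product mult_mono')
  qed measurable
  have lin: "bounded_linear (\<lambda>X :: real^'m^'m. b \<bullet> (X *v b))"
    by (simp add: linear_conv_bounded_linear[symmetric] linear_iff matrix_vector_mult_add_rdistrib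
        inner_add_right scaleR_matrix_vector_assoc[symmetric])
  have eq: "b \<bullet> (outer_product (z \<omega>) (z \<omega>) *v b) = (z \<omega> \<bullet> b)\<^sup>2" for \<omega>
    by (simp add: outer_product_mult power2_eq_square inner_commute)
  show "integrable M (\<lambda>\<omega>. (z \<omega> \<bullet> b)\<^sup>2)"
    using integrable_bounded_linear[OF lin int] by (simp add: eq)
  show "expectation (\<lambda>\<omega>. (z \<omega> \<bullet> b)\<^sup>2) = b \<bullet> (E *v b)"
    using integral_bounded_linear[OF lin int] by (simp add: eq E)
qed

text \<open>Taking expectations in \<open>trace_exp_rank_one\<close> gives tr(e^A) + b tr(E e^A),
  and the tangent inequality moves \<open>b E\<close> back into the exponent.\<close>

lemma trace_exp_rank_one_expectation:
  fixes z :: "'a \<Rightarrow> real^'m"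
  assumes z: "random_variable borel z" "AE \<omega> in M. norm (z \<omega>) \<le> L"
      "expectation (\<lambda>\<omega>. outer_product (z \<omega>) (z \<omega>)) = E"
    and E: "transpose E = E" and A: "transpose A = A"
    and ab: "\<And>y :: real^'m. norm y \<le> L \<Longrightarrow> exp (a * (norm y)\<^sup>2) - 1 \<le> b * (norm y)\<^sup>2"
  shows "(\<integral>\<^sup>+\<omega>. trace_exp (A + a *\<^sub>R outer_product (z \<omega>) (z \<omega>)) \<partial>M) \<le> ennreal (trace_exp (A + b *\<^sub>R E))"
proof -
  obtain B \<nu> where B: "eigenbasis A B \<nu>" using symmetric_eigenbasis[OF A] .
  note quad = second_moment_quad_form[OF z]
  let ?g = "\<lambda>\<omega>. trace_exp A + b * quad_exp A (z \<omega>)"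
  have int: "integrable M ?g"
    unfolding quad_exp_eigenbasis[OF B] by (intro Bochner_Integration.integrable_add integrable_const integrable_mult_right
        Bochner_Integration.integrable_sum quad)
  have le: "AE \<omega> in M. trace_exp (A + a *\<^sub>R outer_product (z \<omega>) (z \<omega>)) \<le> ?g \<omega>"
    using z(2) by eventually_elim (intro trace_exp_rank_one A ab)
  have pos: "0 \<le> trace_exp (A + a *\<^sub>R outer_product y y)" for y
    by (intro trace_exp_nonneg) (simp add: transpose_add A transpose_scaleR transpose_outer_product)
  \<comment> \<open>As \<open>b\<close> may be negative, nonnegativity of the bound comes from its
    dominating a trace exponential.\<close>
  have nonneg: "AE \<omega> in M. 0 \<le> ?g \<omega>"
    using le
  proof eventually_elim
    case (elim \<omega>)
    then show ?case using pos[of "z \<omega>"] by linarith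
  qed
  have "(\<integral>\<^sup>+\<omega>. trace_exp (A + a *\<^sub>R outer_product (z \<omega>) (z \<omega>)) \<partial>M) \<le> (\<integral>\<^sup>+\<omega>. ?g \<omega> \<partial>M)"
    using le by (intro nn_integral_mono_AE) (auto elim: eventually_mono intro: ennreal_leI)
  also have "\<dots> = ennreal (expectation ?g)"
    using int nonneg by (rule nn_integral_eq_integral)
  also have "expectation ?g = trace_exp A + b * (\<Sum>c\<in>B. exp (\<nu> c) * (c \<bullet> (E *v c)))"
    unfolding quad_exp_eigenbasis[OF B] by (simp add: quad prob_space)
  also have "\<dots> = (\<Sum>c\<in>B. exp (\<nu> c) * (1 + c \<bullet> ((b *\<^sub>R E) *v c)))"
    unfolding trace_exp_eigenbasis[OF B]
    by (simp add: scaleR_matrix_vector_assoc[symmetric] distrib_left sum.distrib sum_distrib_left mult_ac)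
  also have "ennreal \<dots> \<le> ennreal (trace_exp (A + b *\<^sub>R E))"
    by (intro ennreal_leI trace_exp_tangent B transpose_scaleR E)
  finally show ?thesis .
qed

text \<open>Integrating out one vector replaces its rank-one term by the deterministic
  \<open>b E\<close>, which is absorbed into \<open>A\<close>; hence the induction over
  \<open>J\<close> generalises \<open>A\<close>.\<close>

lemma trace_exp_sum_expectation:
  fixes z :: "'i \<Rightarrow> 'a \<Rightarrow> real^'m"
  assumes "finite J" and "indep_vars (\<lambda>_. borel) z J"
    and "\<And>j. j \<in> J \<Longrightarrow> AE \<omega> in M. norm (z j \<omega>) \<le> L"
    and "\<And>j. j \<in> J \<Longrightarrow> expectation (\<lambda>\<omega>. outer_product (z j \<omega>) (z j \<omega>)) = E"
    and E: "transpose E = E" and "transpose A = A"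
    and ab: "\<And>y :: real^'m. norm y \<le> L \<Longrightarrow> exp (a * (norm y)\<^sup>2) - 1 \<le> b * (norm y)\<^sup>2"
  shows "(\<integral>\<^sup>+\<omega>. trace_exp (A + (\<Sum>j\<in>J. a *\<^sub>R outer_product (z j \<omega>) (z j \<omega>))) \<partial>M)
       \<le> ennreal (trace_exp (A + (real (card J) * b) *\<^sub>R E))"
  using assms(1-4) \<open>transpose A = A\<close>
proof (induction J arbitrary: A rule: finite_induct)
  case empty
  then show ?case by (simp add: emeasure_space_1)
next
  case (insert j J)
  let ?U = "\<lambda>\<omega>. \<Sum>i\<in>J. a *\<^sub>R outer_product (z i \<omega>) (z i \<omega>)"
  let ?Y = "\<lambda>\<omega>. outer_product (z j \<omega>) (z j \<omega>)"
  note A = insert.prems(4)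
  have indJ: "indep_vars (\<lambda>_. borel) z J"
    using insert.prems(1) by (rule indep_vars_subset) auto
  have [measurable]: "(\<lambda>x :: real^'m. outer_product x x) \<in> borel_measurable borel"
    by (rule borel_measurable_outer_product)
  have [measurable]: "(trace_exp :: real^'m^'m \<Rightarrow> real) \<in> borel_measurable borel"
    by (rule borel_measurable_trace_exp)
  have "indep_var borel ((\<lambda>f. \<Sum>i\<in>J. a *\<^sub>R outer_product (f i) (f i)) \<circ> (\<lambda>\<omega>. restrict (\<lambda>i. z i \<omega>) J))
      borel ((\<lambda>f. outer_product (f j) (f j)) \<circ> (\<lambda>\<omega>. restrict (\<lambda>i. z i \<omega>) {j}))"
    using insert.hyps by (intro indep_var_compose[OF indep_var_restrict[OF insert.prems(1)]]) auto
  also have "(\<lambda>f. \<Sum>i\<in>J. a *\<^sub>R outer_product (f i) (f i)) \<circ> (\<lambda>\<omega>. restrict (\<lambda>i. z i \<omega>) J) = ?U"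
    by (auto simp: fun_eq_iff intro!: sum.cong)
  also have "(\<lambda>f. outer_product (f j) (f j)) \<circ> (\<lambda>\<omega>. restrict (\<lambda>i. z i \<omega>) {j}) = ?Y"
    by auto
  finally have ind: "indep_var borel ?U borel ?Y" .
  have sym: "transpose (A + ?U \<omega>) = A + ?U \<omega>" for \<omega>
    using insert.hyps(1) by (induction J rule: finite_induct)
      (simp_all add: A transpose_add transpose_scaleR transpose_outer_product)
  have zj: "random_variable borel (z j)"
    using insert.prems(1) by (auto simp: indep_vars_def)
  have f: "(\<lambda>(u, y). ennreal (trace_exp (A + u + a *\<^sub>R y)))
      \<in> borel_measurable (borel \<Otimes>\<^sub>M borel)"
    by measurable
  have "(\<integral>\<^sup>+\<omega>. trace_exp (A + (\<Sum>i\<in>insert j J. a *\<^sub>R outer_product (z i \<omega>) (z i \<omega>))) \<partial>M)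
      = (\<integral>\<^sup>+\<omega>. trace_exp (A + ?U \<omega> + a *\<^sub>R outer_product (z j \<omega>) (z j \<omega>)) \<partial>M)"
    using insert.hyps by (simp add: add_ac)
  also have "\<dots> = (\<integral>\<^sup>+\<omega>. \<integral>\<^sup>+\<omega>'. trace_exp (A + ?U \<omega> + a *\<^sub>R outer_product (z j \<omega>') (z j \<omega>')) \<partial>M \<partial>M)"
    using nn_integral_indep_var[OF ind f] by simp
  \<comment> \<open>For each frozen \<open>\<omega>\<close>, the matrix
    \<open>A + ?U \<omega>\<close> plays the role of \<open>A\<close> in the one-vector
    bound.\<close>
  also have "\<dots> \<le> (\<integral>\<^sup>+\<omega>. ennreal (trace_exp (A + ?U \<omega> + b *\<^sub>R E)) \<partial>M)"
    using insert.prems zj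
    by (intro nn_integral_mono trace_exp_rank_one_expectation[where L = L] E sym ab) auto
  also have "\<dots> = (\<integral>\<^sup>+\<omega>. ennreal (trace_exp ((A + b *\<^sub>R E) + ?U \<omega>)) \<partial>M)"
    by (simp add: add_ac)
  also have "\<dots> \<le> ennreal (trace_exp ((A + b *\<^sub>R E) + (real (card J) * b) *\<^sub>R E))"
    using insert.prems by (intro insert.IH indJ) (simp_all add: transpose_add transpose_scaleR E)
  also have "(A + b *\<^sub>R E) + (real (card J) * b) *\<^sub>R E = A + (real (card (insert j J)) * b) *\<^sub>R E"
    using insert.hyps by (simp add: algebra_simps)
  finally show ?case .
qed

end

section \<open>Scalar exponential bounds of Bernstein type\<close>

text \<open>Bernstein's bound exp x <= 1 + x + (x^2/2) / (1 - x/3), multiplied out, combined with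
  the second assumption in the form x <= epsilon (1 - x/3).\<close>

lemma exp_minus_one_le_bernstein:
  fixes x \<epsilon> :: real
  assumes x: "0 \<le> x" "x * (1 + \<epsilon> / 3) \<le> \<epsilon>" and \<epsilon>: "0 < \<epsilon>"
  shows "exp x - 1 \<le> (1 + \<epsilon> / 2) * x"
proof -
  have "x * (1 + \<epsilon> / 3) < 3 * (1 + \<epsilon> / 3)" using x \<epsilon> by simp
  then have x3: "x < 3" using \<epsilon> mult_right_less_imp_less by fastforce
  have "(1 - x / 3) * exp x \<le> 1 + 2 * x / 3 + x\<^sup>2 / 6"
  proof -
    \<comment> \<open>The claim, multiplied by \<open>6 * exp (- x)\<close>, says that
      \<open>h x\<close> is at least \<open>h 0 = 6\<close>; the derivative of \<open>h\<close> is
      nonnegative by the quadratic Taylor bound for \<open>exp\<close>.\<close>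
    define h where "h t = exp (- t) * (6 + 4 * t + t\<^sup>2) + 2 * t" for t :: real
    have "h 0 \<le> h x"
    proof (rule DERIV_nonneg_imp_nondecreasing[OF x(1)])
      fix t :: real assume t: "0 \<le> t"
      have "(h has_real_derivative (2 - exp (- t) * (2 + 2 * t + t\<^sup>2))) (at t)"
        unfolding h_def by (auto intro!: derivative_eq_intros simp: algebra_simps)
      moreover have "exp (- t) * (2 + 2 * t + t\<^sup>2) \<le> exp (- t) * (2 * exp t)"
        using exp_lower_Taylor_quadratic[OF t] by (intro mult_left_mono) auto
      then have "0 \<le> 2 - exp (- t) * (2 + 2 * t + t\<^sup>2)" by (simp add: mult.left_commute flip: exp_add)
      ultimately show "\<exists>y. (h has_real_derivative y) (at t) \<and> 0 \<le> y" by blast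
    qed
    then have "6 - 2 * x \<le> exp (- x) * (6 + 4 * x + x\<^sup>2)" by (simp add: h_def)
    then have "exp x * (6 - 2 * x) \<le> exp x * (exp (- x) * (6 + 4 * x + x\<^sup>2))"
      by (rule mult_left_mono) simp
    also have "\<dots> = 6 + 4 * x + x\<^sup>2" by (simp add: exp_minus)
    finally show ?thesis by (simp add: algebra_simps)
  qed
  also have "\<dots> \<le> (1 - x / 3) * (1 + (1 + \<epsilon> / 2) * x)"
    using mult_left_mono[OF x(2) x(1)] by (simp add: algebra_simps power2_eq_square)
  finally have "exp x \<le> 1 + (1 + \<epsilon> / 2) * x"
    using x3 by (simp add: mult_le_cancel_left)
  then show ?thesis by simp
qed

text \<open>The product of \<open>1 - x + x\<^sup>2 / 2\<close> and
  \<open>1 + x + x\<^sup>2 / 2\<close> is \<open>1 + x\<^sup>4 / 4\<close>, so the first factor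
  dominates \<open>exp (- x)\<close>; then one factor of \<open>x\<^sup>2\<close> is bounded by
  \<open>\<epsilon>\<close>.\<close>

lemma exp_uminus_minus_one_le:
  fixes x \<epsilon> :: real
  assumes x: "0 \<le> x" "x \<le> \<epsilon>"
  shows "exp (- x) - 1 \<le> - (1 - \<epsilon> / 2) * x"
proof -
  have p: "0 < 1 + x + x\<^sup>2 / 2" using x by (simp add: add_pos_nonneg)
  have "exp (- x) \<le> inverse (1 + x + x\<^sup>2 / 2)"
    unfolding exp_minus using exp_lower_Taylor_quadratic[OF x(1)] p by (intro le_imp_inverse_le) auto
  also have "\<dots> \<le> 1 - x + x\<^sup>2 / 2"
  proof -
    have "1 \<le> (1 - x + x\<^sup>2 / 2) * (1 + x + x\<^sup>2 / 2)"
      using zero_le_power2[of "x\<^sup>2"] by (simp add: algebra_simps power2_eq_square)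
    then show ?thesis using p by (simp add: inverse_eq_divide divide_le_eq)
  qed
  also have "\<dots> \<le> 1 - x + \<epsilon> * x / 2"
    using mult_right_mono[OF x(2) x(1)] by (simp add: power2_eq_square)
  finally show ?thesis by (simp add: algebra_simps)
qed

section \<open>The concentration bound\<close>

lemma spectral_norm_scaleR: "spectral_norm (c *\<^sub>R A) = \<bar>c\<bar> * spectral_norm A"
  using onorm_scaleR[OF matrix_vector_mul_bounded_linear, of c A]
  by (simp add: spectral_norm_def scaleR_matrix_vector_assoc)

lemma borel_measurable_empirical_second_moment:
  assumes "\<And>j. j \<in> {1..n} \<Longrightarrow> z j \<in> borel_measurable M"
  shows "empirical_second_moment n z \<in> borel_measurable M"
proof -
  have "(\<lambda>\<omega>. \<Sum>j=1..n. outer_product (z j \<omega>) (z j \<omega>)) \<in> borel_measurable M"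
    by (intro borel_measurable_sum measurable_compose[OF _ borel_measurable_outer_product] assms)
  then show ?thesis
    unfolding empirical_second_moment_def[abs_def] by measurable
qed

text \<open>The factors \<open>2 * l\<close> and \<open>l\<close> differ because the event means
  that \<open>\<theta> S\<close> has norm above \<open>\<theta> \<epsilon> v = 2 l\<close>, whereas
  the expectations are bounded through the matrix \<open>\<theta> (\<epsilon> / 2) E\<close>, of
  norm \<open>l\<close>.\<close>

lemma (in prob_space) empirical_second_moment_tail:
  fixes z :: "nat \<Rightarrow> 'a \<Rightarrow> real^'m" and E :: "real^'m^'m"
  assumes n: "1 \<le> n" and E: "sym_psd E" "E \<noteq> 0"
    and ind: "indep_vars (\<lambda>_. borel) z {1..n}"
    and mean: "\<And>j. j \<in> {1..n} \<Longrightarrow> expectation (\<lambda>\<omega>. outer_product (z j \<omega>) (z j \<omega>)) = E"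
    and L: "0 < L" and bound: "\<And>j. j \<in> {1..n} \<Longrightarrow> AE \<omega> in M. norm (z j \<omega>) \<le> L"
    and \<epsilon>: "0 < \<epsilon>"
    and l: "l = real n * \<epsilon>\<^sup>2 * spectral_norm E / (2 * L\<^sup>2 * (1 + \<epsilon> / 3))"
  shows "2 * (cosh (2 * l) - 1) * prob {\<omega> \<in> space M. \<epsilon> * spectral_norm E < spectral_norm (empirical_second_moment n z \<omega> - E)}
       \<le> 2 * (intdim E * (exp l - 1))"
proof -
  define v where "v = spectral_norm E"
  have v: "0 < v" unfolding v_def using E by (intro spectral_norm_pos)
  \<comment> \<open>\<open>\<theta> = n a\<close> is the optimal parameter \<open>t / (V + R t / 3)\<close> of Bernstein's inequality for the
    deviation \<open>t = \<epsilon> v\<close>, the range \<open>R = L\<^sup>2 / n\<close> and the variance \<open>V = R v\<close>.\<close>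
  define a where "a = \<epsilon> / (L\<^sup>2 * (1 + \<epsilon> / 3))"
  have e3: "0 < 1 + \<epsilon> / 3" using \<epsilon> by simp
  have a: "0 < a" "a * L\<^sup>2 * (1 + \<epsilon> / 3) = \<epsilon>"
    using \<epsilon> L e3 by (simp_all add: a_def)
  define \<theta> where "\<theta> = real n * a"
  have \<theta>: "0 < \<theta>" using n a by (simp add: \<theta>_def)
  have l_a: "l = \<theta> * (\<epsilon> / 2) * v"
    unfolding l \<theta>_def a_def v_def by (simp add: power2_eq_square mult_ac)
  have symE: "transpose E = E" using E by (simp add: sym_psd_def)
  define S where "S \<omega> = empirical_second_moment n z \<omega> - E" for \<omega>
  have S: "\<theta> *\<^sub>R S \<omega> = - \<theta> *\<^sub>R E + (\<Sum>j=1..n. a *\<^sub>R outer_product (z j \<omega>) (z j \<omega>))"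
    and S': "- \<theta> *\<^sub>R S \<omega> = \<theta> *\<^sub>R E + (\<Sum>j=1..n. (- a) *\<^sub>R outer_product (z j \<omega>) (z j \<omega>))" for \<omega>
    using n by (simp_all add: S_def empirical_second_moment_def \<theta>_def scaleR_diff_right scaleR_sum_right
        sum_negf)
  have symS: "transpose (S \<omega>) = S \<omega>" for \<omega>
    by (simp add: S_def empirical_second_moment_def transpose_def outer_product_def vec_eq_iff mult.commute
        symE[unfolded transpose_def vec_eq_iff, simplified])
  have square_le: "a * (norm y)\<^sup>2 \<le> a * L\<^sup>2" if "norm y \<le> L" for y :: "real^'m"
    using a that by (intro mult_left_mono power_mono) auto
  \<comment> \<open>The centring contributes \<open>- \<theta> E\<close> and the sum
    \<open>(1 + \<epsilon> / 2) \<theta> E\<close>, so only the correction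
    \<open>\<epsilon> / 2\<close> survives. In \<open>lower\<close> the signs are reversed, with
    \<open>1 - \<epsilon> / 2\<close>, and the same matrix results.\<close>
  have upper: "(\<integral>\<^sup>+\<omega>. trace_exp (\<theta> *\<^sub>R S \<omega>) \<partial>M) \<le> ennreal (trace_exp ((\<theta> * (\<epsilon> / 2)) *\<^sub>R E))"
  proof -
    have "(\<integral>\<^sup>+\<omega>. trace_exp (\<theta> *\<^sub>R S \<omega>) \<partial>M)
        \<le> ennreal (trace_exp (- \<theta> *\<^sub>R E + (real (card {1..n}) * ((1 + \<epsilon> / 2) * a)) *\<^sub>R E))"
      unfolding S
    proof (rule trace_exp_sum_expectation[OF _ ind bound mean symE])
      fix y :: "real^'m" assume y: "norm y \<le> L"
      have "a * (norm y)\<^sup>2 * (1 + \<epsilon> / 3) \<le> \<epsilon>"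
        using mult_right_mono[OF square_le[OF y], of "1 + \<epsilon> / 3"] a e3 by simp
      then show "exp (a * (norm y)\<^sup>2) - 1 \<le> (1 + \<epsilon> / 2) * a * (norm y)\<^sup>2"
        using exp_minus_one_le_bernstein[of "a * (norm y)\<^sup>2" \<epsilon>] a \<epsilon> by (simp add: mult.assoc)
    qed (use transpose_scaleR[OF symE, of "- \<theta>"] in simp_all)
    also have "- \<theta> *\<^sub>R E + (real (card {1..n}) * ((1 + \<epsilon> / 2) * a)) *\<^sub>R E = (\<theta> * (\<epsilon> / 2)) *\<^sub>R E"
      unfolding scaleR_add_left[symmetric] by (simp add: \<theta>_def algebra_simps)
    finally show ?thesis .
  qed
  have lower: "(\<integral>\<^sup>+\<omega>. trace_exp (- \<theta> *\<^sub>R S \<omega>) \<partial>M) \<le> ennreal (trace_exp ((\<theta> * (\<epsilon> / 2)) *\<^sub>R E))"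
  proof -
    have "(\<integral>\<^sup>+\<omega>. trace_exp (- \<theta> *\<^sub>R S \<omega>) \<partial>M)
        \<le> ennreal (trace_exp (\<theta> *\<^sub>R E + (real (card {1..n}) * (- (1 - \<epsilon> / 2) * a)) *\<^sub>R E))"
      unfolding S'
    proof (rule trace_exp_sum_expectation[OF _ ind bound mean symE])
      fix y :: "real^'m" assume y: "norm y \<le> L"
      have "a * L\<^sup>2 * 1 \<le> a * L\<^sup>2 * (1 + \<epsilon> / 3)"
        using a \<epsilon> by (intro mult_left_mono) auto
      then have "a * (norm y)\<^sup>2 \<le> \<epsilon>"
        using square_le[OF y] a(2) by linarith
      then show "exp (- a * (norm y)\<^sup>2) - 1 \<le> - (1 - \<epsilon> / 2) * a * (norm y)\<^sup>2"
        using exp_uminus_minus_one_le[of "a * (norm y)\<^sup>2" \<epsilon>] a by (simp add: mult.assoc)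
    qed (auto intro: transpose_scaleR symE)
    also have "\<theta> *\<^sub>R E + (real (card {1..n}) * (- (1 - \<epsilon> / 2) * a)) *\<^sub>R E = (\<theta> * (\<epsilon> / 2)) *\<^sub>R E"
      unfolding scaleR_add_left[symmetric] by (simp add: \<theta>_def algebra_simps)
    finally show ?thesis .
  qed
  define G where "G = {\<omega> \<in> space M. \<epsilon> * v < spectral_norm (S \<omega>)}"
  have [measurable]: "empirical_second_moment n z \<in> borel_measurable M"
    using ind by (intro borel_measurable_empirical_second_moment) (auto simp: indep_vars_def)
  then have [measurable]: "S \<in> borel_measurable M"
    unfolding S_def by measurable
  have [measurable]: "(spectral_norm :: real^'m^'m \<Rightarrow> real) \<in> borel_measurable borel"
    "(trace_exp :: real^'m^'m \<Rightarrow> real) \<in> borel_measurable borel"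
    by (rule borel_measurable_spectral_norm borel_measurable_trace_exp)+
  have G: "G \<in> events" unfolding G_def by measurable
  define N where "N = 2 * trace_exp (0 :: real^'m^'m)"
  define K where "K = 2 * (cosh (2 * l) - 1)"
  have NK: "0 \<le> N" "0 \<le> K"
    using cosh_real_ge_1[of "2 * l"] trace_exp_nonneg[of "0 :: real^'m^'m"]
    by (simp_all add: N_def K_def transpose_def vec_eq_iff)
  have sym: "transpose (c *\<^sub>R S \<omega>) = c *\<^sub>R S \<omega>" for c \<omega>
    by (rule transpose_scaleR[OF symS])
  \<comment> \<open>Markov's inequality before integration: \<open>N\<close> is the baseline present
    everywhere, and \<open>K\<close> the excess forced on \<open>G\<close>.\<close>
  have pointwise: "N + K * indicator G \<omega> \<le> trace_exp (\<theta> *\<^sub>R S \<omega>) + trace_exp (- \<theta> *\<^sub>R S \<omega>)" for \<omega>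
  proof (cases "\<omega> \<in> G")
    case True
    have "2 * l = \<theta> * (\<epsilon> * v)" by (simp add: l_a)
    also have "\<dots> < spectral_norm (\<theta> *\<^sub>R S \<omega>)"
      using True \<theta> by (simp add: G_def spectral_norm_scaleR)
    finally show ?thesis
      using True \<theta> \<epsilon> v trace_exp_add_uminus_ge_cosh[OF sym, of "2 * l" \<theta> \<omega>]
      by (simp add: N_def K_def l_a)
  next
    case False
    then show ?thesis using trace_exp_add_uminus_ge[OF sym, of \<theta> \<omega>] by (simp add: N_def)
  qed
  define T where "T = trace_exp ((\<theta> * (\<epsilon> / 2)) *\<^sub>R E)"
  have T: "0 \<le> T" unfolding T_def by (intro trace_exp_nonneg transpose_scaleR symE)
  have int: "integrable M (indicator G :: 'a \<Rightarrow> real)"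
    using G by (intro integrable_real_indicator) (auto simp: less_top[symmetric])
  then have "expectation (\<lambda>\<omega>. N + K * indicator G \<omega>) = N + K * prob G"
    using G by (simp add: prob_space)
  then have "ennreal (N + K * prob G) = (\<integral>\<^sup>+\<omega>. ennreal (N + K * indicator G \<omega>) \<partial>M)"
    using int NK by (subst nn_integral_eq_integral) auto
  also have "\<dots> \<le> (\<integral>\<^sup>+\<omega>. ennreal (trace_exp (\<theta> *\<^sub>R S \<omega>)) + ennreal (trace_exp (- \<theta> *\<^sub>R S \<omega>)) \<partial>M)"
    using pointwise trace_exp_nonneg[OF sym, of \<theta>] trace_exp_nonneg[OF sym, of "- \<theta>"]
    by (intro nn_integral_mono) (simp add: ennreal_leI flip: ennreal_plus)
  also have "\<dots> = (\<integral>\<^sup>+\<omega>. ennreal (trace_exp (\<theta> *\<^sub>R S \<omega>)) \<partial>M) + (\<integral>\<^sup>+\<omega>. ennreal (trace_exp (- \<theta> *\<^sub>R S \<omega>)) \<partial>M)"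
    by (intro nn_integral_add) measurable
  also have "\<dots> \<le> ennreal T + ennreal T"
    unfolding T_def by (intro add_mono upper lower)
  also have "\<dots> = ennreal (2 * T)" using T by (simp flip: ennreal_plus)
  finally have "N + K * prob G \<le> 2 * T" using T by (simp add: ennreal_le_iff)
  moreover have "T \<le> trace_exp (0 :: real^'m^'m) + intdim E * (exp l - 1)"
    using trace_exp_intdim_le[OF E, of "\<theta> * (\<epsilon> / 2)"] \<theta> \<epsilon> by (simp add: T_def l_a v_def)
  ultimately show ?thesis by (simp add: N_def K_def G_def S_def v_def)
qed

theorem theorem2p1:
  fixes M :: "'a measure"
    and z :: "nat \<Rightarrow> 'a \<Rightarrow> real^'m"
    and E :: "real^'m^'m"
    and n :: nat
    and L \<delta> \<gamma> :: real
  assumes "prob_space M"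
    and "n \<ge> 1"
    and "sym_psd E" and "E \<noteq> 0"
    and "prob_space.indep_vars M (\<lambda>_. borel) z {1..n}"
    and "\<And>j. j \<in> {1..n} \<Longrightarrow> (\<integral>\<omega>. outer_product (z j \<omega>) (z j \<omega>) \<partial>M) = E"
    and "L > 0"
    and "\<And>j. j \<in> {1..n} \<Longrightarrow> AE \<omega> in M. norm (z j \<omega>) \<le> L"
    and "spectral_norm E \<le> L\<^sup>2"
    and "0 < \<delta>" and "\<delta> < 1"
    and "\<gamma> = 1 / (3 * real n) * (L\<^sup>2 / spectral_norm E) * ln (4 / \<delta> * intdim E)"
  shows "measure M {\<omega> \<in> space M.
           spectral_norm (empirical_second_moment n z \<omega> - E) / spectral_norm E
             \<le> \<gamma> + sqrt (\<gamma> * (\<gamma> + 6))} \<ge> 1 - \<delta>"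
proof -
  interpret prob_space M by fact
  define v where "v = spectral_norm E"
  have v: "0 < v" unfolding v_def using assms by (intro spectral_norm_pos)
  define d where "d = intdim E"
  have d: "1 \<le> d" unfolding d_def using assms by (intro intdim_ge_1)
  define x where "x = 4 / \<delta> * d"
  have "4 / 1 * 1 < 4 / \<delta> * d"
    using d assms by (intro mult_less_le_imp_less divide_strict_left_mono) auto
  then have x: "4 < x" "x * \<delta> = 4 * d" using assms by (simp_all add: x_def)
  define l where "l = ln x"
  have l: "0 < l" "exp l = x" using x by (simp_all add: l_def)
  have \<gamma>: "\<gamma> = L\<^sup>2 * l / (3 * real n * v)"
    using assms(12) by (simp add: l_def x_def d_def v_def)
  have \<gamma>0: "0 < \<gamma>" unfolding \<gamma> using l v assms by simp
  \<comment> \<open>This is the positive root of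
    \<open>\<epsilon>\<^sup>2 = 2 \<gamma> \<epsilon> + 6 \<gamma>\<close>, which makes the exponent
    of the tail bound exactly \<open>l = ln x\<close>.\<close>
  define \<epsilon> where "\<epsilon> = \<gamma> + sqrt (\<gamma> * (\<gamma> + 6))"
  have \<epsilon>: "0 < \<epsilon>" unfolding \<epsilon>_def using \<gamma>0 by (intro add_pos_nonneg) auto
  have "(\<epsilon> - \<gamma>)\<^sup>2 = \<gamma> * (\<gamma> + 6)" unfolding \<epsilon>_def using \<gamma>0 by simp
  then have "\<epsilon>\<^sup>2 = 6 * \<gamma> * (1 + \<epsilon> / 3)" by (simp add: power2_eq_square algebra_simps)
  then have "real n * \<epsilon>\<^sup>2 * v / (2 * L\<^sup>2 * (1 + \<epsilon> / 3)) = real n * (6 * \<gamma>) * v / (2 * L\<^sup>2)"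
    using \<epsilon> by simp
  also have "\<dots> = l" unfolding \<gamma> using assms v by simp
  finally have l\<epsilon>: "l = real n * \<epsilon>\<^sup>2 * spectral_norm E / (2 * L\<^sup>2 * (1 + \<epsilon> / 3))"
    by (simp add: v_def)
  define G where "G = {\<omega> \<in> space M. \<epsilon> * v < spectral_norm (empirical_second_moment n z \<omega> - E)}"
  have tail: "2 * (cosh (2 * l) - 1) * prob G \<le> 2 * (d * (x - 1))"
    using empirical_second_moment_tail[OF assms(2-8) \<epsilon> l\<epsilon>] by (simp add: G_def v_def d_def l)
  \<comment> \<open>Since \<open>exp l = x\<close>, the factor \<open>2 * (cosh (2 * l) - 1)\<close>
    is at least \<open>x\<^sup>2 - 2\<close>. Weakening this to \<open>x * (x - 1) / 2\<close> lets
    \<open>x - 1\<close> cancel and leaves \<open>x * prob G \<le> 4 * d = x * \<delta>\<close>,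
    which explains the 4 in the logarithm.\<close>
  have "16 \<le> x\<^sup>2" using x(1) mult_mono[of 4 x 4 x] by (simp add: power2_eq_square)
  moreover have "x * (x - 1) = x\<^sup>2 - x" by (simp add: power2_eq_square algebra_simps)
  ultimately have "x * (x - 1) / 2 \<le> x\<^sup>2 - 2" using x(1) by simp
  also have "\<dots> \<le> 2 * (cosh (2 * l) - 1)"
    using l(2) exp_double[of l] by (simp add: cosh_def)
  finally have "x * (x - 1) / 2 * prob G \<le> 2 * (d * (x - 1))"
    using tail by (meson measure_nonneg mult_right_mono order_trans)
  then have "(x - 1) * (x * prob G) \<le> (x - 1) * (x * \<delta>)"
    unfolding x(2) by (simp add: field_simps)
  moreover have "0 < x - 1" "0 < x" using x(1) by auto
  ultimately have small: "prob G \<le> \<delta>" by (meson mult_left_le_imp_le)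
  have ev: "{\<omega> \<in> space M. spectral_norm (empirical_second_moment n z \<omega> - E) / spectral_norm E
      \<le> \<gamma> + sqrt (\<gamma> * (\<gamma> + 6))} = space M - G"
    using v by (auto simp: G_def \<epsilon>_def[symmetric] v_def[symmetric] divide_le_eq not_less)
  have [measurable]: "empirical_second_moment n z \<in> borel_measurable M"
    using assms(5) by (intro borel_measurable_empirical_second_moment) (auto simp: indep_vars_def)
  have [measurable]: "(spectral_norm :: real^'m^'m \<Rightarrow> real) \<in> borel_measurable borel"
    by (rule borel_measurable_spectral_norm)
  have "G \<in> events" unfolding G_def by measurable
  then show ?thesis unfolding ev using small by (simp add: prob_compl)
qed

end
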